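(* Fix an integer $n\ge2$. Let $\preceq$ be a $312$-avoiding TITO, and let $\mathcal A(\preceq)=\{\gamma_{a_1,b_1},\ldots,\gamma_{a_k,b_k}\}$ be its arc diagram. Then $$\preceq\,=\,j_{a_1,b_1}\vee\cdots\vee j_{a_k,b_k},$$ and $\{j_{a_1,b_1},\ldots,j_{a_k,b_k}\}$ is the canonical join representation of $\preceq$ in the cyclic Tamari lattice $\mathsf{CTam}_{312}$.
   Context: Fix an integer $n\ge 2$. A translation-invariant total order (TITO) is a total order $\preceq$ on $\mathbb Z$ such that $a\preceq b$ iff $a+n\preceq b+n$. A reflection index is a pair $(a,b)$ of integers with $a<b$, up to simultaneous translation by multiples of $n$. An inversion of $\preceq$ is a reflection index $(a,b)$ with $b\preceq a$; $\mathrm{Inv}(\preceq)$ is the set of inversions. A TITO is $312$-avoiding if there are no integers $a<b<c$ with $c\preceq a\preceq b$. $\mathsf{CTam}_{312}$ is the set of $312$-avoiding TITOs, ordered by $\preceq_1\,\le\,\preceq_2$ iff $\mathrm{Inv}(\preceq_1)\subseteq\mathrm{Inv}(\preceq_2)$; it is a finite semidistributive lattice. A lower wall of $\preceq$ is a reflection index $(a,b)$ such that $b\prec a$ and no integer lies strictly between $b$ and $a$ in $\preceq$. The arc diagram $\mathcal A(\preceq)$ is the set of symbols (arcs) $\gamma_{a,b}$ with $(a,b)$ a lower wall of $\preceq$; for $312$-avoiding $\preceq$ every lower wall satisfies $b\le a+n$. Window notation: $[a_1,\ldots,a_k]$ denotes the block $\cdots\prec a_1\prec\cdots\prec a_k\prec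 a_1+n\prec\cdots\prec a_k+n\prec\cdots$, and $[\underline{a_1,\ldots,a_k}]$ denotes the block $\cdots\prec a_1\prec\cdots\prec a_k\prec a_1-n\prec\cdots\prec a_k-n\prec\cdots$; a concatenation of windows denotes the TITO whose blocks appear left to right in that order. For a reflection index $(a,b)$ with $b\le a+n$, $j_{a,b}$ is the unique join-irreducible element of $\mathsf{CTam}_{312}$ with lower wall $(a,b)$: if $b<a+n$, then $j_{a,b}=[b+1-n,b+2-n,\ldots,\widehat a,\ldots,b-1,b,a]$ (the entry $a$ is omitted from the increasing list $b+1-n,\ldots,b$ and appended at the end); if $b=a+n$, then $j_{a,b}=[a-n+1,\ldots,a-1][\underline a]$. In a finite semidistributive lattice $L$, each join-irreducible $j$ covers a unique element $j_*$; set $\kappa(j)=\max\{z\in L\mid z\wedge j=j_*\}$. For each cover relation $x\lessdot y$ in $L$ there is a unique join-irreducible $\mathfrak j(x\lessdot y)$ with $\mathfrak j(x\lessdot y)\vee x=y$ and $\kappa(\mathfrak j(x\lessdot y))\wedge y=x$. The canonical join representation of $u\in L$ is $\{\mathfrak j(x\lessdot u)\mid x\lessdot u\}$. *)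

theory Defs
  imports "HOL-Algebra.Lattice"
begin

section \<open>Translation-invariant total orders\<close>

text \<open>A relation \<open>r\<close> encodes the order \<open>\<preceq>\<close> by \<open>(a, b) \<in> r \<longleftrightarrow> a \<preceq> b\<close>.\<close>

definition tito :: "int \<Rightarrow> int rel \<Rightarrow> bool" where
  "tito n r \<longleftrightarrow> linear_order r \<and> (\<forall>a b. (a, b) \<in> r \<longleftrightarrow> (a + n, b + n) \<in> r)"

text \<open>A reflection index is the class of a pair \<open>a < b\<close> modulo simultaneous translation by multiples
  of \<open>n\<close>. The arc \<open>\<gamma>\<^sub>a\<^sub>,\<^sub>b\<close> is a formal symbol for such a class and is identified with it.\<close>

definition refl_index :: "int \<Rightarrow> int \<Rightarrow> int \<Rightarrow> (int \<times> int) set" where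
  "refl_index n a b = {(a + m * n, b + m * n) | m. True}"

definition Inv :: "int \<Rightarrow> int rel \<Rightarrow> (int \<times> int) set set" where
  "Inv n r = {refl_index n a b | a b. a < b \<and> (b, a) \<in> r}"

definition avoids_312 :: "int rel \<Rightarrow> bool" where
  "avoids_312 r \<longleftrightarrow> \<not> (\<exists>a b c. a < b \<and> b < c \<and> (c, a) \<in> r \<and> (a, b) \<in> r)"

definition CTam312 :: "int \<Rightarrow> int rel gorder" where
  "CTam312 n = \<lparr>carrier = {r. tito n r \<and> avoids_312 r}, eq = (=),
                le = (\<lambda>r s. Inv n r \<subseteq> Inv n s)\<rparr>"

definition lower_wall :: "int rel \<Rightarrow> int \<Rightarrow> int \<Rightarrow> bool" where
  "lower_wall r a b \<longleftrightarrow> a < b \<and> (b, a) \<in> r \<and>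
     \<not> (\<exists>c. c \<noteq> a \<and> c \<noteq> b \<and> (b, c) \<in> r \<and> (c, a) \<in> r)"

definition arc_diagram :: "int \<Rightarrow> int rel \<Rightarrow> (int \<times> int) set set" where
  "arc_diagram n r = {refl_index n a b | a b. lower_wall r a b}"


section \<open>Window notation\<close>

text \<open>\<open>Incr [a\<^sub>1, \<dots>, a\<^sub>k]\<close> is the plain window, \<open>Decr [a\<^sub>1, \<dots>, a\<^sub>k]\<close> the underlined one.\<close>

datatype window = Incr "int list" | Decr "int list"

text \<open>\<open>window_pos n ws x (i, m, p)\<close>: the integer \<open>x\<close> lies in the \<open>i\<close>-th block, in the \<open>m\<close>-th repetition
  of its window, at position \<open>p\<close>; the \<open>m\<close>-th repetition is the window shifted by \<open>m * n\<close>, or by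
  \<open>- m * n\<close> if underlined.\<close>

fun window_pos :: "int \<Rightarrow> window list \<Rightarrow> int \<Rightarrow> nat \<times> int \<times> nat \<Rightarrow> bool" where
  "window_pos n ws x (i, m, p) \<longleftrightarrow> i < length ws \<and>
     (case ws ! i of
        Incr as \<Rightarrow> p < length as \<and> x = as ! p + m * n
      | Decr as \<Rightarrow> p < length as \<and> x = as ! p - m * n)"

fun pos_le :: "nat \<times> int \<times> nat \<Rightarrow> nat \<times> int \<times> nat \<Rightarrow> bool" where
  "pos_le (i, m, p) (i', m', p') \<longleftrightarrow>
     i < i' \<or> i = i' \<and> (m < m' \<or> m = m' \<and> p \<le> p')"

text \<open>Meaningful when the entries of the windows represent every residue class modulo \<open>n\<close>
  exactly once, so that every integer has exactly one position.\<close>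

definition window_order :: "int \<Rightarrow> window list \<Rightarrow> int rel" where
  "window_order n ws =
     {(x, y). \<exists>s t. window_pos n ws x s \<and> window_pos n ws y t \<and> pos_le s t}"

text \<open>Only used for \<open>a < b \<le> a + n\<close>, so the last branch is the case \<open>b = a + n\<close>.\<close>

definition j_elt :: "int \<Rightarrow> int \<Rightarrow> int \<Rightarrow> int rel" where
  "j_elt n a b =
     (if b < a + n
      then window_order n [Incr (filter (\<lambda>x. x \<noteq> a) [b + 1 - n..b] @ [a])]
      else window_order n [Incr [a - n + 1..a - 1], Decr [a]])"


section \<open>Canonical join representations in finite semidistributive lattices\<close>

text \<open>These notions are used for orders \<open>L\<close> whose equivalence \<open>eq\<close> is equality.\<close>

definition covers :: "('a, 'm) gorder_scheme \<Rightarrow> 'a \<Rightarrow> 'a \<Rightarrow> bool" where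
  "covers L x y \<longleftrightarrow> x \<in> carrier L \<and> y \<in> carrier L \<and> x \<sqsubset>\<^bsub>L\<^esub> y \<and>
     \<not> (\<exists>z \<in> carrier L. x \<sqsubset>\<^bsub>L\<^esub> z \<and> z \<sqsubset>\<^bsub>L\<^esub> y)"

definition join_irreducible :: "('a, 'm) gorder_scheme \<Rightarrow> 'a \<Rightarrow> bool" where
  "join_irreducible L j \<longleftrightarrow> j \<in> carrier L \<and> \<not> least L j (carrier L) \<and>
     (\<forall>x \<in> carrier L. \<forall>y \<in> carrier L. j = x \<squnion>\<^bsub>L\<^esub> y \<longrightarrow> j = x \<or> j = y)"

definition lower_cover :: "('a, 'm) gorder_scheme \<Rightarrow> 'a \<Rightarrow> 'a" where
  "lower_cover L j = (THE x. covers L x j)"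

definition kappa :: "('a, 'm) gorder_scheme \<Rightarrow> 'a \<Rightarrow> 'a" where
  "kappa L j = (THE k. greatest L k {z \<in> carrier L. z \<sqinter>\<^bsub>L\<^esub> j = lower_cover L j})"

definition cover_label :: "('a, 'm) gorder_scheme \<Rightarrow> 'a \<Rightarrow> 'a \<Rightarrow> 'a" where
  "cover_label L x y =
     (THE j. join_irreducible L j \<and> j \<squnion>\<^bsub>L\<^esub> x = y \<and> kappa L j \<sqinter>\<^bsub>L\<^esub> y = x)"

definition canonical_join_rep :: "('a, 'm) gorder_scheme \<Rightarrow> 'a \<Rightarrow> 'a set" where
  "canonical_join_rep L u = {cover_label L x u | x. covers L x u}"


section \<open>Arc diagrams are finite and their arcs are short\<close>

lemma tito_shift:
  assumes "tito n r"
  shows "(a + m * n, b + m * n) \<in> r \<longleftrightarrow> (a, b) \<in> r"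
proof -
  have nat_shift: "(a + int k * n, b + int k * n) \<in> r \<longleftrightarrow> (a, b) \<in> r" for a b k
  proof (induction k)
    case (Suc k)
    have "(a + int k * n + n, b + int k * n + n) \<in> r \<longleftrightarrow> (a + int k * n, b + int k * n) \<in> r"
      using assms unfolding tito_def by blast
    then show ?case using Suc by (simp add: algebra_simps)
  qed simp
  show ?thesis
  proof (cases "m \<ge> 0")
    case True
    then show ?thesis using nat_shift[of a "nat m" b] by simp
  next
    case False
    then show ?thesis using nat_shift[of "a + m * n" "nat (- m)" "b + m * n"] by simp
  qed
qed

lemma lower_wall_shift:
  assumes "tito n r" "lower_wall r a b"
  shows "lower_wall r (a + m * n) (b + m * n)"
  unfolding lower_wall_def
proof (intro conjI notI)
  show "a + m * n < b + m * n" "(b + m * n, a + m * n) \<in> r"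
    using assms tito_shift[OF assms(1)] by (auto simp: lower_wall_def)
  assume "\<exists>c. c \<noteq> a + m * n \<and> c \<noteq> b + m * n \<and> (b + m * n, c) \<in> r \<and> (c, a + m * n) \<in> r"
  then obtain c where "c \<noteq> a + m * n" "c \<noteq> b + m * n" "(b + m * n, c) \<in> r" "(c, a + m * n) \<in> r"
    by blast
  then show False
    using assms(2) tito_shift[OF assms(1), of b m "c - m * n"]
      tito_shift[OF assms(1), of "c - m * n" m a]
    unfolding lower_wall_def by (auto dest!: spec[of _ "c - m * n"])
qed

lemma lower_wall_unique:
  assumes "tito n r" "lower_wall r a b" "lower_wall r a' b"
  shows "a = a'"
  using assms unfolding tito_def linear_order_on_def partial_order_on_def antisym_def total_on_def
    lower_wall_def by (metis UNIV_I order_less_irrefl)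

lemma finite_arc_diagram:
  assumes "n > 0" "tito n r"
  shows "finite (arc_diagram n r)"
proof -
  have "arc_diagram n r \<subseteq> (\<lambda>b. refl_index n (THE a. lower_wall r a b) b) ` {0..<n}"
  proof
    fix A assume "A \<in> arc_diagram n r"
    then obtain a b where A: "A = refl_index n a b" and w: "lower_wall r a b"
      unfolding arc_diagram_def by blast
    define m where "m = - (b div n)"
    have b: "b + m * n = b mod n"
      by (simp add: m_def minus_div_mult_eq_mod [symmetric])
    have w': "lower_wall r (a + m * n) (b mod n)"
      using lower_wall_shift[OF assms(2) w, of m] b by simp
    have the: "(THE a. lower_wall r a (b mod n)) = a + m * n"
      using w' lower_wall_unique[OF assms(2)] by blast
    have "refl_index n (a + m * n) (b + m * n) = refl_index n a b"
    proof -
      have "\<exists>k'. a + m * n + k * n = a + k' * n \<and> b + m * n + k * n = b + k' * n" for k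
        by (rule exI[of _ "m + k"]) (simp add: algebra_simps)
      moreover have "\<exists>k'. a + k * n = a + m * n + k' * n \<and> b + k * n = b + m * n + k' * n" for k
        by (rule exI[of _ "k - m"]) (simp add: algebra_simps)
      ultimately show ?thesis unfolding refl_index_def by blast
    qed
    then have "A = refl_index n (THE a. lower_wall r a (b mod n)) (b mod n)"
      using A the b by simp
    moreover have "b mod n \<in> {0..<n}" using assms(1) by simp
    ultimately show "A \<in> (\<lambda>b. refl_index n (THE a. lower_wall r a b) b) ` {0..<n}" by blast
  qed
  then show ?thesis by (rule finite_subset) simp
qed

lemma lower_wall_le:
  assumes "n > 0" "tito n r" "avoids_312 r" "lower_wall r a b"
  shows "b \<le> a + n"
proof (rule ccontr)
  assume "\<not> b \<le> a + n"
  then have lt: "a + n < b" by simp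
  have tot: "(x, y) \<in> r \<or> (y, x) \<in> r" for x y
    using assms(2) unfolding tito_def linear_order_on_def partial_order_on_def preorder_on_def
      refl_on_def total_on_def by (metis UNIV_I)
  have ba: "(b, a) \<in> r" using assms(4) by (simp add: lower_wall_def)
  have avoid: "\<not> ((c, x) \<in> r \<and> (x, y) \<in> r)" if "x < y" "y < c" for x y c
    using assms(3) that unfolding avoids_312_def by blast
  have "(a + n, a) \<in> r"
    using avoid[of a "a + n" b] tot[of a "a + n"] lt assms(1) ba by auto
  then have "(a + n, b) \<in> r"
    using assms(1,4) lt tot[of "a + n" b] unfolding lower_wall_def
    by (auto dest!: spec[of _ "a + n"])
  then have "(a, b - n) \<in> r"
    using tito_shift[OF assms(2), of "a + n" "- 1" b] by simp
  then show False using avoid[of a "b - n" b] lt assms(1) ba by auto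
qed

end

theory Submission
  imports Defs
begin

text \<open>
  A \<open>312\<close>-avoiding order is determined by its set of inversions \<open>I\<close>, the pairs \<open>a < b\<close> with \<open>b\<close> before
  \<open>a\<close>. The sets that occur are the translation-invariant, transitive ones in which every row
  \<open>{b. (a, b) \<in> I}\<close> is an initial segment of the integers above \<open>a\<close>: avoidance of \<open>312\<close> is the
  statement about rows, and it already forces the complement of \<open>I\<close> to be transitive. These sets
  are closed under intersection, so the order is inclusion, meets are intersections, and all joins
  exist (\<open>meet_CTam312\<close>, \<open>sup_CTam312\<close>).

  In this picture \<open>j\<^sub>a\<^sub>,\<^sub>b\<close> is the least element whose inversions contain \<open>(a, b)\<close>, so
  \<open>j\<^sub>a\<^sub>,\<^sub>b \<le> r\<close> just says that \<open>(a, b)\<close> is an inversion of \<open>r\<close> (\<open>arc_subset_iff\<close>). Its lower cover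
  drops \<open>(a, b)\<close> and its translates, together with all inversions beyond \<open>b\<close> in the row of
  \<open>a\<close>. Hence \<open>\<kappa>(j\<^sub>a\<^sub>,\<^sub>b)\<close> is the largest element whose row of \<open>a\<close> ends exactly at \<open>b - 1\<close>: rows
  that start in \<open>{a..<b}\<close> must stop before \<open>b\<close>, likewise for
  their translates, and nothing else is restricted (\<open>kappa_j\<close>).

  A lower wall \<open>(a, b)\<close> of \<open>r\<close> is an inversion such that no row starting strictly between \<open>a\<close>
  and \<open>b\<close> reaches \<open>b\<close>, while the row of \<open>b\<close> reaches as far as the row of \<open>a\<close>. Every nonempty row
  contains a wall, and following the walls \<open>a < b < b' < \<dots>\<close> upwards recovers all inversions by
  transitivity. So an element that contains all walls of \<open>r\<close> lies above \<open>r\<close>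
  (\<open>subset_if_walls\<close>), which is the join formula.

  The same fact describes the lower covers of \<open>r\<close>. An element strictly below \<open>r\<close> misses some wall
  \<open>(a, b)\<close>, and then lies below \<open>r \<sqinter> \<kappa>(j\<^sub>a\<^sub>,\<^sub>b)\<close>. This meet loses only \<open>(a, b)\<close> among the walls, up
  to translation, so adding \<open>(a, b)\<close> back gives \<open>r\<close>. Thus the lower covers are exactly these
  meets and \<open>j\<^sub>a\<^sub>,\<^sub>b\<close> satisfies the two label equations. For uniqueness of the label, two walls that
  are not translates of each other give two different lower covers with join \<open>r\<close>, so a
  join-irreducible element has a single wall and is some \<open>j\<^sub>c\<^sub>,\<^sub>d\<close>; and
  \<open>r \<sqinter> \<kappa>(j\<^sub>c\<^sub>,\<^sub>d) = r \<sqinter> \<kappa>(j\<^sub>a\<^sub>,\<^sub>b)\<close> with \<open>j\<^sub>c\<^sub>,\<^sub>d \<le> r\<close> forces \<open>(c, d)\<close> to be a translate of \<open>(a, b)\<close>.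
\<close>

section \<open>Inversion sets of 312-avoiding orders\<close>

definition inversions :: "int rel \<Rightarrow> (int \<times> int) set" where
  "inversions r = {(a, b). a < b \<and> (b, a) \<in> r}"

text \<open>The inverse of \<open>inversions\<close>: the natural order of the integers with the pairs in \<open>I\<close> reversed.\<close>

definition order_with :: "(int \<times> int) set \<Rightarrow> int rel" where
  "order_with I = {(x, y). x = y \<or> x < y \<and> (x, y) \<notin> I \<or> y < x \<and> (y, x) \<in> I}"

text \<open>The sets of inversions of \<open>312\<close>-avoiding orders. The last clause encodes the avoidance: if \<open>c\<close>
  precedes \<open>a\<close> and \<open>a < b < c\<close>, then \<open>b\<close> precedes \<open>a\<close> as well.\<close>

definition tamari_set :: "int \<Rightarrow> (int \<times> int) set \<Rightarrow> bool" where
  "tamari_set n I \<longleftrightarrow>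
     (\<forall>a b. (a, b) \<in> I \<longrightarrow> a < b) \<and>
     (\<forall>a b. (a, b) \<in> I \<longleftrightarrow> (a + n, b + n) \<in> I) \<and>
     trans I \<and>
     (\<forall>a b c. (a, c) \<in> I \<longrightarrow> a < b \<longrightarrow> b < c \<longrightarrow> (a, b) \<in> I)"

lemma tamari_setI:
  assumes "\<And>a b. (a, b) \<in> I \<Longrightarrow> a < b"
    and "\<And>a b. (a, b) \<in> I \<longleftrightarrow> (a + n, b + n) \<in> I"
    and "\<And>a b c. (a, b) \<in> I \<Longrightarrow> (b, c) \<in> I \<Longrightarrow> (a, c) \<in> I"
    and "\<And>a b c. (a, c) \<in> I \<Longrightarrow> a < b \<Longrightarrow> b < c \<Longrightarrow> (a, b) \<in> I"
  shows "tamari_set n I"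
  unfolding tamari_set_def trans_def using assms by blast

lemma
  assumes "tamari_set n I"
  shows tamari_less: "(a, b) \<in> I \<Longrightarrow> a < b"
    and tamari_trans: "(a, b) \<in> I \<Longrightarrow> (b, c) \<in> I \<Longrightarrow> (a, c) \<in> I"
    and tamari_shrink: "(a, c) \<in> I \<Longrightarrow> a < b \<Longrightarrow> b \<le> c \<Longrightarrow> (a, b) \<in> I"
  using assms unfolding tamari_set_def trans_def by (blast, blast, metis order_le_less)

lemma order_with_iff:
  assumes "a < b"
  shows "(b, a) \<in> order_with I \<longleftrightarrow> (a, b) \<in> I" "(a, b) \<in> order_with I \<longleftrightarrow> (a, b) \<notin> I"
  using assms unfolding order_with_def by auto

lemma antisym_order_with: "antisym (order_with I)"
  unfolding order_with_def antisym_def by auto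

text \<open>Transitivity of the order needs both \<open>I\<close> and its complement to be transitive. The complement is
  so because rows are initial segments: if \<open>(x, y)\<close> is missing, then so is every \<open>(x, z)\<close> with
  \<open>z > y\<close>.\<close>

lemma tito_order_with:
  assumes I: "tamari_set n I"
  shows "tito n (order_with I)"
proof -
  have "trans (order_with I)"
  proof (rule transI)
    fix x y z assume xy: "(x, y) \<in> order_with I" and yz: "(y, z) \<in> order_with I"
    consider "x = y" | "y = z" | "x < y" "(x, y) \<notin> I" "y < z" "(y, z) \<notin> I"
      | "x < y" "(x, y) \<notin> I" "(z, y) \<in> I" | "(y, x) \<in> I" "y < z" "(y, z) \<notin> I"
      | "(y, x) \<in> I" "(z, y) \<in> I"
      using xy yz unfolding order_with_def by auto
    then show "(x, z) \<in> order_with I"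
    proof cases
      case 3
      then show ?thesis using tamari_shrink[OF I, of x z y] by (auto simp: order_with_iff)
    next
      case 4
      have "(x, z) \<notin> I" using 4 tamari_trans[OF I] by blast
      moreover have "(z, x) \<in> I" if "z < x" using 4 that tamari_shrink[OF I, of z y x] by simp
      ultimately show ?thesis unfolding order_with_def by (simp; linarith)
    next
      case 5
      have "(x, z) \<notin> I" using 5 tamari_trans[OF I] by blast
      moreover have "(z, x) \<in> I" if "z < x" using 5 that tamari_shrink[OF I, of y x z] by simp
      ultimately show ?thesis unfolding order_with_def by (simp; linarith)
    next
      case 6
      then have "(z, x) \<in> I" by (blast intro: tamari_trans[OF I])
      then show ?thesis using tamari_less[OF I] order_with_iff by blast
    qed (use xy yz in auto)
  qed
  then have "linear_order (order_with I)"
    unfolding linear_order_on_def partial_order_on_def preorder_on_def refl_on_def total_on_def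
    using antisym_order_with by (auto simp: order_with_def)
  moreover have "(a, b) \<in> order_with I \<longleftrightarrow> (a + n, b + n) \<in> order_with I" for a b
    using I unfolding tamari_set_def order_with_def by auto
  ultimately show ?thesis unfolding tito_def by blast
qed

lemma inversions_order_with: "tamari_set n I \<Longrightarrow> inversions (order_with I) = I"
  unfolding inversions_def order_with_def by (auto dest: tamari_less)

lemma tito_facts:
  assumes "tito n r"
  shows tito_trans: "(x, y) \<in> r \<Longrightarrow> (y, z) \<in> r \<Longrightarrow> (x, z) \<in> r"
    and tito_total: "(x, y) \<in> r \<or> (y, x) \<in> r"
    and tito_antisym: "(x, y) \<in> r \<Longrightarrow> (y, x) \<in> r \<Longrightarrow> x = y"
  using assms unfolding tito_def linear_order_on_def partial_order_on_def preorder_on_def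
    refl_on_def total_on_def trans_def antisym_def by (blast, metis UNIV_I, blast)

lemma order_with_inversions: "tito n r \<Longrightarrow> order_with (inversions r) = r"
  unfolding order_with_def inversions_def
  using tito_total[of n r] tito_antisym[of n r] by (auto simp: set_eq_iff)

text \<open>Passing to classes modulo translation loses nothing, since the orders are translation-invariant.\<close>

lemma Inv_subset_iff:
  assumes "tito n r" "tito n s"
  shows "Inv n r \<subseteq> Inv n s \<longleftrightarrow> inversions r \<subseteq> inversions s"
proof
  assume le: "Inv n r \<subseteq> Inv n s"
  show "inversions r \<subseteq> inversions s"
  proof
    fix p assume "p \<in> inversions r"
    then obtain a b where p: "p = (a, b)" "a < b" "(b, a) \<in> r"
      unfolding inversions_def by auto
    then have "refl_index n a b \<in> Inv n s"
      using le unfolding Inv_def by blast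
    then obtain c d where cd: "refl_index n a b = refl_index n c d" "(d, c) \<in> s"
      unfolding Inv_def by blast
    have "(a + 0 * n, b + 0 * n) \<in> refl_index n a b" unfolding refl_index_def by blast
    then obtain m where "a = c + m * n" "b = d + m * n"
      unfolding cd(1) by (auto simp: refl_index_def)
    then have "(b, a) \<in> s" using cd(2) tito_shift[OF assms(2)] by simp
    then show "p \<in> inversions s" using p unfolding inversions_def by simp
  qed
next
  assume "inversions r \<subseteq> inversions s"
  then have "a < b \<Longrightarrow> (b, a) \<in> r \<Longrightarrow> (b, a) \<in> s" for a b
    unfolding inversions_def by auto
  then show "Inv n r \<subseteq> Inv n s" unfolding Inv_def by blast
qed

lemma carrier_CTam312: "r \<in> carrier (CTam312 n) \<longleftrightarrow> tito n r \<and> avoids_312 r"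
  unfolding CTam312_def by simp

lemma tamari_set_inversions:
  assumes "r \<in> carrier (CTam312 n)"
  shows "tamari_set n (inversions r)"
proof (rule tamari_setI)
  have t: "tito n r" and av: "avoids_312 r" using assms by (auto simp: carrier_CTam312)
  fix a b c
  show "(a, b) \<in> inversions r \<Longrightarrow> a < b" by (simp add: inversions_def)
  show "(a, b) \<in> inversions r \<longleftrightarrow> (a + n, b + n) \<in> inversions r"
    using t unfolding inversions_def tito_def by auto
  show "(a, b) \<in> inversions r \<Longrightarrow> (b, c) \<in> inversions r \<Longrightarrow> (a, c) \<in> inversions r"
    using tito_trans[OF t] unfolding inversions_def by auto
  show "(a, c) \<in> inversions r \<Longrightarrow> a < b \<Longrightarrow> b < c \<Longrightarrow> (a, b) \<in> inversions r"
    using av tito_total[OF t, of a b] unfolding inversions_def avoids_312_def by auto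
qed

lemma order_with_carrier:
  assumes "tamari_set n I"
  shows "order_with I \<in> carrier (CTam312 n)"
proof -
  have "avoids_312 (order_with I)"
    unfolding avoids_312_def
    using tamari_shrink[OF assms] by (metis less_imp_le order_less_trans order_with_iff)
  then show ?thesis using tito_order_with[OF assms] by (simp add: carrier_CTam312)
qed

lemma inversions_inject:
  assumes "r \<in> carrier (CTam312 n)" "s \<in> carrier (CTam312 n)" "inversions r = inversions s"
  shows "r = s"
  by (metis assms carrier_CTam312 order_with_inversions)

lemma le_CTam312:
  assumes "r \<in> carrier (CTam312 n)" "s \<in> carrier (CTam312 n)"
  shows "r \<sqsubseteq>\<^bsub>CTam312 n\<^esub> s \<longleftrightarrow> inversions r \<subseteq> inversions s"
  using assms Inv_subset_iff by (simp add: CTam312_def)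

lemma tamari_shift:
  assumes "tamari_set n I"
  shows "(a + m * n, b + m * n) \<in> I \<longleftrightarrow> (a, b) \<in> I"
proof (cases a b rule: linorder_less_linear[THEN disjE])
  case 1
  then show ?thesis
    using tito_shift[OF tito_order_with[OF assms], of b m a] by (simp add: order_with_iff)
next
  case 2
  then show ?thesis using tamari_less[OF assms, of a b]
      tamari_less[OF assms, of "a + m * n" "b + m * n"] by auto
qed

text \<open>The defining conditions are Horn clauses, hence stable under intersections.\<close>

lemma tamari_set_Inter:
  assumes "\<And>I. I \<in> \<I> \<Longrightarrow> tamari_set n I" "\<I> \<noteq> {}"
  shows "tamari_set n (\<Inter>\<I>)"
proof (rule tamari_setI)
  fix a b c
  show "(a, b) \<in> \<Inter>\<I> \<Longrightarrow> a < b" using assms tamari_less by (metis InterE ex_in_conv)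
  show "(a, b) \<in> \<Inter>\<I> \<longleftrightarrow> (a + n, b + n) \<in> \<Inter>\<I>"
    using assms(1) unfolding tamari_set_def by blast
  show "(a, b) \<in> \<Inter>\<I> \<Longrightarrow> (b, c) \<in> \<Inter>\<I> \<Longrightarrow> (a, c) \<in> \<Inter>\<I>"
    using assms(1) tamari_trans by blast
  show "(a, c) \<in> \<Inter>\<I> \<Longrightarrow> a < b \<Longrightarrow> b < c \<Longrightarrow> (a, b) \<in> \<Inter>\<I>"
    using assms(1) tamari_shrink by (metis InterE InterI less_imp_le)
qed

lemma tamari_set_Int: "tamari_set n I \<Longrightarrow> tamari_set n J \<Longrightarrow> tamari_set n (I \<inter> J)"
  using tamari_set_Inter[of "{I, J}"] by auto

lemma tamari_set_top: "tamari_set n {(a, b). a < b}"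
  by (rule tamari_setI) auto

section \<open>Meets and joins in the cyclic Tamari lattice\<close>

lemma partial_order_CTam312: "partial_order (CTam312 n)"
proof
  fix x y z
  assume c: "x \<in> carrier (CTam312 n)" "y \<in> carrier (CTam312 n)" "z \<in> carrier (CTam312 n)"
  show "x \<sqsubseteq>\<^bsub>CTam312 n\<^esub> y \<Longrightarrow> y \<sqsubseteq>\<^bsub>CTam312 n\<^esub> z \<Longrightarrow> x \<sqsubseteq>\<^bsub>CTam312 n\<^esub> z"
    using c by (simp add: le_CTam312)
  show "x \<sqsubseteq>\<^bsub>CTam312 n\<^esub> y \<Longrightarrow> y \<sqsubseteq>\<^bsub>CTam312 n\<^esub> x \<Longrightarrow> x .=\<^bsub>CTam312 n\<^esub> y"
    unfolding le_CTam312[OF c(1,2)] le_CTam312[OF c(2,1)]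
    using inversions_inject[OF c(1,2)] by (simp add: CTam312_def)
qed (auto simp: CTam312_def)

lemma lless_CTam312:
  assumes "r \<in> carrier (CTam312 n)" "s \<in> carrier (CTam312 n)"
  shows "r \<sqsubset>\<^bsub>CTam312 n\<^esub> s \<longleftrightarrow> inversions r \<subset> inversions s"
proof -
  have "r .=\<^bsub>CTam312 n\<^esub> s \<longleftrightarrow> r = s" by (simp add: CTam312_def)
  then show ?thesis
    using le_CTam312[OF assms] inversions_inject[OF assms] unfolding lless_def by blast
qed

lemma covers_CTam312:
  "covers (CTam312 n) x y \<longleftrightarrow> x \<in> carrier (CTam312 n) \<and> y \<in> carrier (CTam312 n) \<and>
     inversions x \<subset> inversions y \<and>
     (\<forall>z \<in> carrier (CTam312 n). inversions x \<subset> inversions z \<longrightarrow> \<not> inversions z \<subset> inversions y)"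
  unfolding covers_def by (metis lless_CTam312)

lemma meet_CTam312:
  assumes "r \<in> carrier (CTam312 n)" "s \<in> carrier (CTam312 n)"
  shows "r \<sqinter>\<^bsub>CTam312 n\<^esub> s = order_with (inversions r \<inter> inversions s)"
proof -
  interpret partial_order "CTam312 n" by (rule partial_order_CTam312)
  let ?m = "order_with (inversions r \<inter> inversions s)"
  have I: "tamari_set n (inversions r \<inter> inversions s)"
    using assms by (simp add: tamari_set_Int tamari_set_inversions)
  note m = order_with_carrier[OF I] inversions_order_with[OF I]
  have gr: "greatest (CTam312 n) ?m (Lower (CTam312 n) {r, s})"
    unfolding greatest_def
  proof (intro conjI ballI)
    have "?m \<sqsubseteq>\<^bsub>CTam312 n\<^esub> r" "?m \<sqsubseteq>\<^bsub>CTam312 n\<^esub> s"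
      by (simp_all only: le_CTam312 m assms Int_lower1 Int_lower2)
    then show "?m \<in> Lower (CTam312 n) {r, s}"
      unfolding Lower_def using m by blast
    fix z assume "z \<in> Lower (CTam312 n) {r, s}"
    then have "z \<in> carrier (CTam312 n)" "z \<sqsubseteq>\<^bsub>CTam312 n\<^esub> r" "z \<sqsubseteq>\<^bsub>CTam312 n\<^esub> s"
      unfolding Lower_def using assms by blast+
    then show "z \<sqsubseteq>\<^bsub>CTam312 n\<^esub> ?m"
      by (simp only: le_CTam312 m assms Int_subset_iff)
  qed (auto simp: Lower_def)
  show ?thesis
    unfolding meet_def inf_def
  proof (rule some_equality)
    show "x = ?m" if "greatest (CTam312 n) x (Lower (CTam312 n) {r, s})" for x
      using that gr by (rule greatest_unique)
  qed (rule gr)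
qed

lemma inversions_meet:
  assumes "r \<in> carrier (CTam312 n)" "s \<in> carrier (CTam312 n)"
  shows "inversions (r \<sqinter>\<^bsub>CTam312 n\<^esub> s) = inversions r \<inter> inversions s"
  unfolding meet_CTam312[OF assms]
  by (rule inversions_order_with[OF tamari_set_Int]) (use assms tamari_set_inversions in blast)+

lemma sup_CTam312_eqI:
  assumes "u \<in> carrier (CTam312 n)" "A \<subseteq> carrier (CTam312 n)"
    and "\<And>x. x \<in> A \<Longrightarrow> inversions x \<subseteq> inversions u"
    and "\<And>z. z \<in> carrier (CTam312 n) \<Longrightarrow> (\<And>x. x \<in> A \<Longrightarrow> inversions x \<subseteq> inversions z) \<Longrightarrow>
           inversions u \<subseteq> inversions z"
  shows "\<Squnion>\<^bsub>CTam312 n\<^esub> A = u"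
proof -
  interpret partial_order "CTam312 n" by (rule partial_order_CTam312)
  have le: "least (CTam312 n) u (Upper (CTam312 n) A)"
    unfolding least_def
  proof (intro conjI ballI)
    show "u \<in> Upper (CTam312 n) A"
      unfolding Upper_def using assms(1,3) le_CTam312[of _ n u] by blast
    fix z assume "z \<in> Upper (CTam312 n) A"
    then have "z \<in> carrier (CTam312 n)" "\<And>x. x \<in> A \<Longrightarrow> x \<sqsubseteq>\<^bsub>CTam312 n\<^esub> z"
      unfolding Upper_def using assms(2) by blast+
    then have z: "z \<in> carrier (CTam312 n)" and "\<And>x. x \<in> A \<Longrightarrow> inversions x \<subseteq> inversions z"
      using assms(2) le_CTam312[of _ n z] by blast+
    then show "u \<sqsubseteq>\<^bsub>CTam312 n\<^esub> z"
      unfolding le_CTam312[OF assms(1) z] by (rule assms(4))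
  qed (auto simp: Upper_def)
  show ?thesis
    unfolding sup_def
  proof (rule some_equality)
    show "x = u" if "least (CTam312 n) x (Upper (CTam312 n) A)" for x
      using that le by (rule least_unique)
  qed (rule le)
qed

text \<open>The join of \<open>A\<close> is given by the intersection of all admissible sets that contain the inversions of
  every element of \<open>A\<close>; there is at least one such set, belonging to the reversed order of the integers.\<close>

lemma sup_CTam312:
  assumes A: "A \<subseteq> carrier (CTam312 n)"
  shows "\<Squnion>\<^bsub>CTam312 n\<^esub> A \<in> carrier (CTam312 n)"
    and "x \<in> A \<Longrightarrow> inversions x \<subseteq> inversions (\<Squnion>\<^bsub>CTam312 n\<^esub> A)"
    and "z \<in> carrier (CTam312 n) \<Longrightarrow> (\<And>x. x \<in> A \<Longrightarrow> inversions x \<subseteq> inversions z) \<Longrightarrow>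
           inversions (\<Squnion>\<^bsub>CTam312 n\<^esub> A) \<subseteq> inversions z"
proof -
  define \<U> where "\<U> = {I. tamari_set n I \<and> (\<forall>x\<in>A. inversions x \<subseteq> I)}"
  have "{(a, b). a < b} \<in> \<U>"
    unfolding \<U>_def using tamari_set_top by (auto simp: inversions_def)
  then have U: "tamari_set n (\<Inter>\<U>)"
    by (intro tamari_set_Inter) (auto simp: \<U>_def)
  have "inversions z \<in> \<U>"
    if "z \<in> carrier (CTam312 n)" "\<And>x. x \<in> A \<Longrightarrow> inversions x \<subseteq> inversions z" for z
    using that tamari_set_inversions unfolding \<U>_def by blast
  then have least: "\<Inter>\<U> \<subseteq> inversions z"
    if "z \<in> carrier (CTam312 n)" "\<And>x. x \<in> A \<Longrightarrow> inversions x \<subseteq> inversions z" for z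
    using that by blast
  have upper: "inversions x \<subseteq> \<Inter>\<U>" if "x \<in> A" for x
    using that unfolding \<U>_def by blast
  have eq: "\<Squnion>\<^bsub>CTam312 n\<^esub> A = order_with (\<Inter>\<U>)"
    by (rule sup_CTam312_eqI)
      (use A least upper order_with_carrier[OF U] inversions_order_with[OF U] in auto)
  show "\<Squnion>\<^bsub>CTam312 n\<^esub> A \<in> carrier (CTam312 n)"
    using order_with_carrier[OF U] by (simp add: eq)
  show "x \<in> A \<Longrightarrow> inversions x \<subseteq> inversions (\<Squnion>\<^bsub>CTam312 n\<^esub> A)"
    using upper by (simp add: eq inversions_order_with[OF U])
  show "inversions (\<Squnion>\<^bsub>CTam312 n\<^esub> A) \<subseteq> inversions z"
    if "z \<in> carrier (CTam312 n)" "\<And>x. x \<in> A \<Longrightarrow> inversions x \<subseteq> inversions z"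
    using least[OF that] by (simp add: eq inversions_order_with[OF U])
qed


section \<open>Inversions of the elements given by windows\<close>

text \<open>The rows of the translates of \<open>a\<close> end at the translates of \<open>b\<close> if \<open>b < a + n\<close>, and are infinite
  if \<open>b = a + n\<close>: a row that reaches \<open>a + n\<close> reaches every \<open>a + k * n\<close> by translation and
  transitivity. All other rows are empty.\<close>

definition arc_inversions :: "int \<Rightarrow> int \<Rightarrow> int \<Rightarrow> (int \<times> int) set" where
  "arc_inversions n a b =
     {(a + m * n, y) | m y. a + m * n < y \<and> (b = a + n \<or> y \<le> b + m * n)}"

lemma arc_inversions_iff:
  "(x, y) \<in> arc_inversions n a b \<longleftrightarrow>
     (\<exists>m. x = a + m * n \<and> x < y \<and> (b = a + n \<or> y \<le> b + m * n))"
  unfolding arc_inversions_def by auto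

lemma shift_unique:
  fixes n :: int
  assumes "0 < n" "f + m * n = g + k * n" "f - g < n" "g - f < n"
  shows "m = k"
proof -
  have "(m - k) * n = g - f" using assms(2) by (simp add: algebra_simps)
  then have "(m - k) * n < 1 * n" "(- 1) * n < (m - k) * n" using assms(3,4) by auto
  then have "m - k < 1" "-1 < m - k" using assms(1) mult_less_cancel_right_pos by blast+
  then show ?thesis by simp
qed

lemma shift_zero:
  fixes n :: int
  assumes "0 < n" "0 \<le> m * n" "m * n < n"
  shows "m = 0"
proof -
  have "m < 1" using mult_less_cancel_right_pos[of n m 1] assms by simp
  moreover have "\<not> m < 0" using mult_neg_pos[of m n] assms by linarith
  ultimately show ?thesis by simp
qed

lemma shift_less:
  fixes n :: int
  assumes "0 < n" "m < k"
  shows "m * n + n \<le> k * n"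
  using mult_right_mono[of "m + 1" k n] assms by (simp add: algebra_simps)

text \<open>Two inversions compose only in the case \<open>b = a + n\<close>: both have to start at translates of \<open>a\<close>,
  which differ by at least \<open>n\<close>, more than the length of a finite row.\<close>

lemma tamari_set_arc:
  assumes "0 < n" "a < b" "b \<le> a + n"
  shows "tamari_set n (arc_inversions n a b)"
proof (rule tamari_setI)
  fix x y z
  show "(x, y) \<in> arc_inversions n a b \<Longrightarrow> x < y" by (auto simp: arc_inversions_iff)
  show "(x, y) \<in> arc_inversions n a b \<longleftrightarrow> (x + n, y + n) \<in> arc_inversions n a b"
    unfolding arc_inversions_iff
  proof
    assume "\<exists>m. x = a + m * n \<and> x < y \<and> (b = a + n \<or> y \<le> b + m * n)"
    then obtain m where "x = a + m * n \<and> x < y \<and> (b = a + n \<or> y \<le> b + m * n)" by blast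
    then show "\<exists>m. x + n = a + m * n \<and> x + n < y + n \<and> (b = a + n \<or> y + n \<le> b + m * n)"
      by (intro exI[of _ "m + 1"]) (auto simp: algebra_simps)
  next
    assume "\<exists>m. x + n = a + m * n \<and> x + n < y + n \<and> (b = a + n \<or> y + n \<le> b + m * n)"
    then obtain m where
      "x + n = a + m * n \<and> x + n < y + n \<and> (b = a + n \<or> y + n \<le> b + m * n)" by blast
    then show "\<exists>m. x = a + m * n \<and> x < y \<and> (b = a + n \<or> y \<le> b + m * n)"
      by (intro exI[of _ "m - 1"]) (auto simp: algebra_simps)
  qed
  show "(x, y) \<in> arc_inversions n a b \<Longrightarrow> x < z \<Longrightarrow> z < y \<Longrightarrow> (x, z) \<in> arc_inversions n a b"
    by (auto simp: arc_inversions_iff)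
  assume "(x, y) \<in> arc_inversions n a b" "(y, z) \<in> arc_inversions n a b"
  then obtain m k where mk: "x = a + m * n" "x < y" "b = a + n \<or> y \<le> b + m * n"
    "y = a + k * n" "y < z" "b = a + n \<or> z \<le> b + k * n"
    unfolding arc_inversions_iff by blast
  have "m < k" using mk(1,2,4) assms(1) by simp
  then have "m * n + n \<le> k * n" using shift_less assms(1) by blast
  then have "b = a + n" using mk(3,4) assms(3) by auto
  then show "(x, z) \<in> arc_inversions n a b"
    using mk by (auto simp: arc_inversions_iff)
qed

text \<open>A total relation contained in an antisymmetric one is equal to it. So it is enough that every
  integer has a position and that comparable positions are ordered correctly.\<close>

lemma window_order_eqI:
  assumes "\<And>x. \<exists>s. window_pos n ws x s"
    and "\<And>x y s t. window_pos n ws x s \<Longrightarrow> window_pos n ws y t \<Longrightarrow> pos_le s t \<Longrightarrow>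
           (x, y) \<in> order_with I"
  shows "window_order n ws = order_with I"
proof
  show sub: "window_order n ws \<subseteq> order_with I"
    using assms(2) unfolding window_order_def by blast
  have tot: "(x, y) \<in> window_order n ws \<or> (y, x) \<in> window_order n ws" for x y
  proof -
    obtain s t where st: "window_pos n ws x s" "window_pos n ws y t" using assms(1) by blast
    have "pos_le s t \<or> pos_le t s" by (cases s; cases t) auto
    then show ?thesis using st unfolding window_order_def by blast
  qed
  show "order_with I \<subseteq> window_order n ws"
  proof clarify
    fix x y assume xy: "(x, y) \<in> order_with I"
    show "(x, y) \<in> window_order n ws"
    proof (rule ccontr)
      assume "(x, y) \<notin> window_order n ws"
      then have yx: "(y, x) \<in> window_order n ws" using tot by blast
      then have "x = y" using sub xy antisymD[OF antisym_order_with] by blast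
      then show False using yx \<open>(x, y) \<notin> window_order n ws\<close> by simp
    qed
  qed
qed

lemma window_residue:
  fixes n :: int
  assumes "0 < n"
  obtains m f where "x = f + m * n" "c \<le> f" "f < c + n"
proof -
  have "x = (c + (x - c) mod n) + ((x - c) div n) * n" by simp
  moreover have "0 \<le> (x - c) mod n" "(x - c) mod n < n" using assms by simp_all
  ultimately show thesis using that[of "c + (x - c) mod n" "(x - c) div n"] by linarith
qed

text \<open>The entries of the window are \<open>n\<close> consecutive integers, in increasing order except for \<open>a\<close>, which
  has been moved behind \<open>a + 1, \<dots>, b\<close>; these are the inversions inside one copy of the window, and
  there are none between different copies.\<close>

lemma j_elt_short:
  assumes "0 < n" "a < b" "b < a + n"
  shows "j_elt n a b = order_with (arc_inversions n a b)"
proof -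
  define F where "F = filter (\<lambda>x. x \<noteq> a) [b + 1 - n..b]"
  have setF: "set F = {b + 1 - n..b} - {a}" unfolding F_def by auto
  have sF: "sorted F" unfolding F_def by (intro sorted_wrt_filter) simp
  have set: "set (F @ [a]) = {b + 1 - n..b}"
    unfolding set_append setF using assms by (simp add: insert_absorb)
  have "window_order n [Incr (F @ [a])] = order_with (arc_inversions n a b)"
  proof (rule window_order_eqI)
    fix x
    obtain m f where x: "x = f + m * n" "b + 1 - n \<le> f" "f < b + 1 - n + n"
      using window_residue[OF assms(1)] by blast
    then have "f \<in> set (F @ [a])" unfolding set by auto
    then obtain p where "p < length (F @ [a])" "(F @ [a]) ! p = f"
      unfolding in_set_conv_nth by blast
    then have "window_pos n [Incr (F @ [a])] x (0, m, p)" using x by simp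
    then show "\<exists>s. window_pos n [Incr (F @ [a])] x s" by blast
  next
    fix x y s t
    assume x: "window_pos n [Incr (F @ [a])] x s" and y: "window_pos n [Incr (F @ [a])] y t"
      and le: "pos_le s t"
    obtain m p where s: "s = (0, m, p)" using x by (cases s) auto
    obtain k q where t: "t = (0, k, q)" using y by (cases t) auto
    define f where "f = (F @ [a]) ! p"
    define g where "g = (F @ [a]) ! q"
    have p: "p < length (F @ [a])" "x = f + m * n" using x unfolding s f_def by simp_all
    have q: "q < length (F @ [a])" "y = g + k * n" using y unfolding t g_def by simp_all
    have "f \<in> {b + 1 - n..b}" "g \<in> {b + 1 - n..b}"
      unfolding set[symmetric] f_def g_def by (intro nth_mem p(1) q(1))+
    then have f: "b + 1 - n \<le> f" "f \<le> b" and g: "b + 1 - n \<le> g" "g \<le> b" by simp_all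
    \<comment> \<open>Only the entry \<open>a\<close> can start an inversion, and its copy fixes the translation.\<close>
    have arc: "j = m \<and> f = a" if "x = a + j * n" for j
    proof -
      have "m = j" using shift_unique[OF assms(1), of f m a j] that p(2) f assms by linarith
      then show ?thesis using that p(2) by simp
    qed
    have "m < k \<or> m = k \<and> p \<le> q" using le unfolding s t by auto
    then consider "m < k" | "m = k" "q = length F" | "m = k" "p \<le> q" "q < length F"
      using q(1) by fastforce
    then show "(x, y) \<in> order_with (arc_inversions n a b)"
    proof cases
      case 1
      then have *: "m * n + n \<le> k * n" using shift_less assms(1) by blast
      then have "x < y" using p q f g by linarith
      moreover have "(x, y) \<notin> arc_inversions n a b"
        unfolding arc_inversions_iff using arc * q g assms(3) by fastforce
      ultimately show ?thesis by (simp add: order_with_iff)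
    next
      case 2
      then have "g = a" unfolding g_def by simp
      consider "f = a" | "f < a" | "a < f" by linarith
      then show ?thesis
      proof cases
        case 1
        then show ?thesis using p q 2 \<open>g = a\<close> by (simp add: order_with_def)
      next
        case lt: 2
        then have "(x, y) \<notin> arc_inversions n a b" "x < y"
          unfolding arc_inversions_iff using arc p q 2 \<open>g = a\<close> by fastforce+
        then show ?thesis by (simp add: order_with_iff)
      next
        case 3
        then have "(y, x) \<in> arc_inversions n a b" "y < x"
          unfolding arc_inversions_iff using p q f 2 \<open>g = a\<close> by auto
        then show ?thesis by (simp add: order_with_iff)
      qed
    next
      case 3
      have "f = F ! p" "g = F ! q" using 3 unfolding f_def g_def by (simp_all add: nth_append)
      then have "f \<le> g" "f \<in> set F" using sorted_nth_mono[OF sF 3(2,3)] 3 by auto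
      then have "x \<le> y" "(x, y) \<notin> arc_inversions n a b"
        unfolding arc_inversions_iff using arc p q 3 setF by auto
      then show ?thesis by (auto simp: order_with_def)
    qed
  qed
  then show ?thesis unfolding j_elt_def F_def using assms(3) by simp
qed

lemma j_elt_long:
  assumes "0 < n"
  shows "j_elt n a (a + n) = order_with (arc_inversions n a (a + n))"
proof -
  let ?ws = "[Incr [a - n + 1..a - 1], Decr [a]]"
  have "window_order n ?ws = order_with (arc_inversions n a (a + n))"
  proof (rule window_order_eqI)
    fix x
    obtain m f where x: "x = f + m * n" "a - n + 1 \<le> f" "f < a - n + 1 + n"
      using window_residue[OF assms] by blast
    show "\<exists>s. window_pos n ?ws x s"
    proof (cases "f = a")
      case True
      \<comment> \<open>Copies of an underlined window are numbered downwards.\<close>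
      then have "window_pos n ?ws x (1, - m, 0)" using x by simp
      then show ?thesis by blast
    next
      case False
      then have "window_pos n ?ws x (0, m, nat (f - (a - n + 1)))" using x by (simp add: nth_upto)
      then show ?thesis by blast
    qed
  next
    fix x y s t
    assume x: "window_pos n ?ws x s" and y: "window_pos n ?ws y t" and le: "pos_le s t"
    have pos: "(\<exists>m p. s = (0, m, p) \<and> p < nat (n - 1) \<and> x = a - n + 1 + int p + m * n) \<or>
        (\<exists>m. s = (1, m, 0) \<and> x = a - m * n)" if "window_pos n ?ws x s" for x s
      using that by (cases s) (auto simp: nth_Cons' nth_upto split: if_splits)
    show "(x, y) \<in> order_with (arc_inversions n a (a + n))"
      using pos[OF x]
    proof (elim disjE exE conjE)
      fix m p assume s: "s = (0, m, p)" and p: "p < nat (n - 1)" and x: "x = a - n + 1 + int p + m * n"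
      have "x \<noteq> a + j * n" for j
        using shift_unique[OF assms, of "a - n + 1 + int p" m a j] x p by auto
      then have nin: "(x, y) \<notin> arc_inversions n a (a + n)" by (simp add: arc_inversions_iff)
      show ?thesis using pos[OF y]
      proof (elim disjE exE conjE)
        fix k q assume t: "t = (0, k, q)" and q: "q < nat (n - 1)"
          and y: "y = a - n + 1 + int q + k * n"
        have "m < k \<or> m = k \<and> p \<le> q" using le unfolding s t by auto
        then have "x \<le> y"
        proof
          assume "m < k"
          then show "x \<le> y" using shift_less[OF assms, of m k] x y p q by linarith
        qed (use x y in auto)
        then show ?thesis using nin by (auto simp: order_with_def)
      next
        fix k assume "y = a - k * n"
        then have "(y, x) \<in> arc_inversions n a (a + n)" if "y < x"
          unfolding arc_inversions_iff using that by (auto intro!: exI[of _ "- k"])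
        then show ?thesis using nin by (auto simp: order_with_def)
      qed
    next
      fix m assume s: "s = (1, m, 0)" and x: "x = a - m * n"
      then obtain k where "t = (1, k, 0)" and y: "y = a - k * n"
        using pos[OF y] le by auto
      then have "m \<le> k" using le s by auto
      then have "m * n \<le> k * n" using assms by (simp add: mult_right_mono)
      then have "y \<le> x" using x y by simp
      moreover have "(y, x) \<in> arc_inversions n a (a + n)" if "y < x"
          unfolding arc_inversions_iff using that y by (auto intro!: exI[of _ "- k"])
      ultimately show ?thesis by (auto simp: order_with_def)
    qed
  qed
  then show ?thesis unfolding j_elt_def by simp
qed

lemma j_elt_eq:
  assumes "0 < n" "a < b" "b \<le> a + n"
  shows "j_elt n a b = order_with (arc_inversions n a b)"
  using assms j_elt_short j_elt_long by (cases "b = a + n") auto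


section \<open>Lower walls in terms of inversions\<close>

text \<open>Read in the order, \<open>b\<close> precedes \<open>a\<close>; the second clause excludes an integer \<open>c\<close> between them with
  \<open>a < c < b\<close>, the third one an integer \<open>c > b\<close>. An integer \<open>c < a\<close> cannot lie between them, as
  \<open>b\<close>, \<open>c\<close>, \<open>a\<close> would be a \<open>312\<close> pattern.\<close>

definition wall :: "(int \<times> int) set \<Rightarrow> int \<Rightarrow> int \<Rightarrow> bool" where
  "wall I a b \<longleftrightarrow> (a, b) \<in> I \<and> (\<forall>c. a < c \<longrightarrow> c < b \<longrightarrow> (c, b) \<notin> I) \<and>
     (\<forall>c. b < c \<longrightarrow> (a, c) \<in> I \<longrightarrow> (b, c) \<in> I)"

lemma lower_wall_iff_wall:
  assumes "r \<in> carrier (CTam312 n)"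
  shows "lower_wall r a b \<longleftrightarrow> wall (inversions r) a b"
proof -
  have t: "tito n r" using assms by (simp add: carrier_CTam312)
  note I = tamari_set_inversions[OF assms]
  have inv: "(x, y) \<in> inversions r \<longleftrightarrow> x < y \<and> (y, x) \<in> r" for x y
    by (simp add: inversions_def)
  show ?thesis
  proof
    assume w: "lower_wall r a b"
    then have ab: "(a, b) \<in> inversions r" by (simp add: inv lower_wall_def)
    have "(c, b) \<notin> inversions r" if "a < c" "c < b" for c
      using w that tamari_shrink[OF I ab that(1)] unfolding lower_wall_def inv by fastforce
    moreover have "(b, c) \<in> inversions r" if "b < c" "(a, c) \<in> inversions r" for c
      using w that tito_total[OF t, of b c] unfolding lower_wall_def inv by fastforce
    ultimately show "wall (inversions r) a b" using ab unfolding wall_def by blast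
  next
    assume w: "wall (inversions r) a b"
    have False if c: "c \<noteq> a" "c \<noteq> b" "(b, c) \<in> r" "(c, a) \<in> r" for c
    proof -
      consider "c < a" | "a < c" "c < b" | "b < c" using c by linarith
      then show False
      proof cases
        case 1
        have "a < b" using w unfolding wall_def inv by blast
        then have "(c, a) \<in> inversions r"
          using tamari_shrink[OF I, of c b a] 1 c(3) unfolding inv by simp
        then show False using tito_antisym[OF t c(4)] c(1) unfolding inv by blast
      next
        case 2
        then show False using w c unfolding wall_def inv by blast
      next
        case 3
        then have "(a, c) \<in> inversions r" using w c unfolding wall_def inv by auto
        then have "(c, b) \<in> r" using w 3 unfolding wall_def inv by blast
        then show False using tito_antisym[OF t c(3)] c(2) by blast
      qed
    qed
    then show "lower_wall r a b" using w unfolding lower_wall_def wall_def inv by blast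
  qed
qed

lemma wall_unique:
  assumes "tamari_set n I" "wall I a b" "wall I a b'"
  shows "b = b'"
proof -
  have *: "\<not> b < b'" if "wall I a b" "wall I a b'" for b b'
    using that tamari_less[OF assms(1)] unfolding wall_def by blast
  show ?thesis using *[OF assms(2,3)] *[OF assms(3,2)] by simp
qed

lemma wall_shift:
  assumes I: "tamari_set n I" and w: "wall I a b"
  shows "wall I (a + m * n) (b + m * n)"
  unfolding wall_def
proof (intro conjI allI impI notI)
  note sh = tamari_shift[OF I]
  show "(a + m * n, b + m * n) \<in> I" using w by (simp add: wall_def sh)
  fix c
  show "(b + m * n, c) \<in> I" if "b + m * n < c" "(a + m * n, c) \<in> I"
    using w that sh[of a m "c - m * n"] sh[of b m "c - m * n"] unfolding wall_def by simp
  show False if "a + m * n < c" "c < b + m * n" "(c, b + m * n) \<in> I"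
    using w that sh[of "c - m * n" m b] unfolding wall_def by simp
qed

text \<open>If the row of \<open>a\<close> reached beyond \<open>a + n\<close> up to \<open>b\<close>, it would contain \<open>b - n\<close>; translating,
  the row of \<open>a + n\<close> would contain \<open>b\<close>, although \<open>a + n\<close> lies between \<open>a\<close> and \<open>b\<close>.\<close>

lemma wall_le:
  assumes "0 < n" "tamari_set n I" "wall I a b"
  shows "b \<le> a + n"
proof (rule ccontr)
  assume "\<not> b \<le> a + n"
  then have "(a, b - n) \<in> I" "(a + n, b) \<notin> I"
    using assms tamari_shrink[OF assms(2), of a b "b - n"] unfolding wall_def by auto
  then show False using tamari_shift[OF assms(2), of a 1 "b - n"] by simp
qed

text \<open>Take the least \<open>b\<close> in the row of \<open>a\<close> whose own row reaches as far as the row of \<open>a\<close>. If some \<open>c\<close>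
  between \<open>a\<close> and \<open>b\<close> had \<open>b\<close> in its row, then by transitivity its row would also reach that
  far, contradicting minimality.\<close>

lemma wall_exists:
  assumes n: "0 < n" and I: "tamari_set n I" and am: "(a, m) \<in> I"
  obtains b where "wall I a b"
proof -
  define S where "S = {b. (a, b) \<in> I \<and> (\<forall>c. b < c \<longrightarrow> (a, c) \<in> I \<longrightarrow> (b, c) \<in> I)}"
  \<comment> \<open>A row that stops before \<open>a + n\<close> has its maximum in \<open>S\<close>; a row that reaches \<open>a + n\<close> has \<open>a + n\<close>
     in \<open>S\<close>, because the row of \<open>a + n\<close> is a translate of it.\<close>
  have "\<exists>b. b \<in> S"
  proof (cases "(a, a + n) \<in> I")
    case True
    have "(a + n, c) \<in> I" if "a + n < c" "(a, c) \<in> I" for c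
      using tamari_shift[OF I, of a 1 "c - n"] tamari_shrink[OF I that(2), of "c - n"] that(1) n
      by simp
    then show ?thesis using True unfolding S_def by blast
  next
    case False
    let ?C = "{c. (a, c) \<in> I}"
    have "?C \<subseteq> {a..a + n}"
    proof
      fix c assume "c \<in> ?C"
      then show "c \<in> {a..a + n}"
        using False tamari_shrink[OF I, of a c "a + n"] tamari_less[OF I, of a c] n by fastforce
    qed
    then have fin: "finite ?C" by (rule finite_subset) simp
    then have "Max ?C \<in> ?C" using am by (intro Max_in) auto
    moreover have "c \<le> Max ?C" if "(a, c) \<in> I" for c using fin that by simp
    ultimately have "Max ?C \<in> S" unfolding S_def by fastforce
    then show ?thesis by blast
  qed
  moreover have less: "a < b" if "b \<in> S" for b
    using that tamari_less[OF I] unfolding S_def by blast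
  ultimately have "\<exists>k::nat. a + int k \<in> S"
    by (metis add_diff_cancel_left' diff_add_cancel add.commute less_imp_le zle_iff_zadd)
  define k where "k = (LEAST k::nat. a + int k \<in> S)"
  have kS: "a + int k \<in> S" unfolding k_def using \<open>\<exists>k::nat. a + int k \<in> S\<close> by (rule LeastI_ex)
  have min: "c \<notin> S" if "a < c" "c < a + int k" for c
    using not_less_Least[of "nat (c - a)" "\<lambda>k. a + int k \<in> S"] that unfolding k_def[symmetric]
    by auto
  define b where "b = a + int k"
  have b: "(a, b) \<in> I" "\<And>c. b < c \<Longrightarrow> (a, c) \<in> I \<Longrightarrow> (b, c) \<in> I"
    using kS unfolding b_def S_def by auto
  have "(c, b) \<notin> I" if c: "a < c" "c < b" for c
  proof
    assume cb: "(c, b) \<in> I"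
    have "(c, d) \<in> I" if "c < d" "(a, d) \<in> I" for d
      using tamari_shrink[OF I cb, of d] tamari_trans[OF I cb b(2)[of d]] that
      by (cases "d \<le> b") auto
    then have "c \<in> S" unfolding S_def using tamari_shrink[OF I b(1), of c] c by auto
    then show False using min c unfolding b_def by blast
  qed
  then have "wall I a b" using b unfolding wall_def by blast
  then show thesis by (rule that)
qed

text \<open>An inversion \<open>(a, m)\<close> either stops before the wall \<open>(a, b)\<close>, or factors through it into \<open>(a, b)\<close> and
  the shorter inversion \<open>(b, m)\<close>.\<close>

lemma subset_if_walls:
  assumes n: "0 < n" and I: "tamari_set n I" and X: "tamari_set n X"
    and walls: "\<And>a b. wall I a b \<Longrightarrow> (a, b) \<in> X"
  shows "I \<subseteq> X"
proof -
  have "(a, m) \<in> X" if "(a, m) \<in> I" for a m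
    using that
  proof (induction "nat (m - a)" arbitrary: a rule: less_induct)
    case less
    obtain b where b: "wall I a b" using wall_exists[OF n I less.prems] .
    then have ab: "(a, b) \<in> X" "a < b" using walls tamari_less[OF X] by blast+
    show ?case
    proof (cases "m \<le> b")
      case True
      then show ?thesis using tamari_shrink[OF X ab(1)] tamari_less[OF I less.prems] by blast
    next
      case False
      then have "(b, m) \<in> I" using b less.prems unfolding wall_def by simp
      then have "(b, m) \<in> X" using less.hyps ab(2) False by simp
      then show ?thesis using tamari_trans[OF X ab(1)] by blast
    qed
  qed
  then show ?thesis by auto
qed

section \<open>Removing a wall\<close>

text \<open>The inversions of \<open>\<kappa>(j\<^sub>a\<^sub>,\<^sub>b)\<close>: rows that start in a translate of \<open>{a..<b}\<close> stop before the
  corresponding translate of \<open>b\<close>; all other rows are infinite.\<close>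

definition kappa_inversions :: "int \<Rightarrow> int \<Rightarrow> int \<Rightarrow> (int \<times> int) set" where
  "kappa_inversions n a b =
     {(x, y). x < y \<and> (\<forall>m. a \<le> x + m * n \<longrightarrow> x + m * n < b \<longrightarrow> y + m * n < b)}"

lemma tamari_set_kappa: "tamari_set n (kappa_inversions n a b)"
proof (rule tamari_setI)
  fix x y z
  show "(x, y) \<in> kappa_inversions n a b \<Longrightarrow> x < y"
    by (simp add: kappa_inversions_def)
  show "(x, y) \<in> kappa_inversions n a b \<longleftrightarrow> (x + n, y + n) \<in> kappa_inversions n a b"
  proof -
    have "(\<forall>m. P m) \<longleftrightarrow> (\<forall>m. P (m + 1))" for P :: "int \<Rightarrow> bool"
      by (metis diff_add_cancel)
    from this[of "\<lambda>m. a \<le> x + m * n \<longrightarrow> x + m * n < b \<longrightarrow> y + m * n < b"]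
    show ?thesis unfolding kappa_inversions_def by (simp add: algebra_simps)
  qed
  show "(x, z) \<in> kappa_inversions n a b"
    if "(x, y) \<in> kappa_inversions n a b" "(y, z) \<in> kappa_inversions n a b"
    unfolding kappa_inversions_def
  proof (clarify, intro conjI allI impI)
    show "x < z" using that unfolding kappa_inversions_def by auto
    fix m assume m: "a \<le> x + m * n" "x + m * n < b"
    then have "a \<le> y + m * n" "y + m * n < b"
      using that(1) unfolding kappa_inversions_def by auto
    then show "z + m * n < b" using that(2) unfolding kappa_inversions_def by auto
  qed
  show "(x, z) \<in> kappa_inversions n a b"
    if "(x, y) \<in> kappa_inversions n a b" "x < z" "z < y"
    using that unfolding kappa_inversions_def by (auto intro: order_less_trans[OF add_strict_right_mono])
qed

lemma not_kappaE:
  assumes "X \<subseteq> {(x, y). x < y}" "(x, y) \<in> X" "(x, y) \<notin> kappa_inversions n a b"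
  obtains m where "a \<le> x + m * n" "x + m * n < b" "b \<le> y + m * n"
  using assms unfolding kappa_inversions_def by (auto simp: not_less)

lemma kappa_top: "a < b \<Longrightarrow> (a, b) \<notin> kappa_inversions n a b"
  unfolding kappa_inversions_def by (auto intro!: exI[of _ 0])

lemma arc_top:
  assumes "a < b"
  shows "(a, b) \<in> arc_inversions n a b"
  unfolding arc_inversions_iff using assms by (auto intro!: exI[of _ 0])

text \<open>A pair outside \<open>kappa_inversions\<close> has a translate that starts in \<open>{a..<b}\<close> and ends at or beyond
  \<open>b\<close>. As rows are initial segments, it yields \<open>(c, b) \<in> X\<close> for some \<open>c\<close> in \<open>{a..<b}\<close>. The next lemmas
  exclude \<open>c > a\<close> for different reasons.\<close>

lemma subset_kappa:
  assumes X: "tamari_set n X" and "(a, b) \<notin> X"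
    and I: "\<And>c. a < c \<Longrightarrow> c < b \<Longrightarrow> (c, b) \<in> X \<Longrightarrow> False"
  shows "X \<subseteq> kappa_inversions n a b"
proof (clarify, rule ccontr)
  fix x y assume xy: "(x, y) \<in> X" "(x, y) \<notin> kappa_inversions n a b"
  then obtain m where m: "a \<le> x + m * n" "x + m * n < b" "b \<le> y + m * n"
    using not_kappaE[of X] tamari_less[OF X] by blast
  then have "(x + m * n, b) \<in> X"
    using tamari_shrink[OF X, of "x + m * n" "y + m * n" b] tamari_shift[OF X] xy(1) by blast
  then show False using assms(2) I m by (metis order_le_less)
qed

lemma subset_kappa_of_wall:
  assumes "tamari_set n X" "(a, b) \<notin> X" "wall I a b" "X \<subseteq> I"
  shows "X \<subseteq> kappa_inversions n a b"
  using assms unfolding wall_def by (intro subset_kappa) blast+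

text \<open>The element \<open>j\<^sub>a\<^sub>,\<^sub>b\<close> is the least one with inversion \<open>(a, b)\<close>. For \<open>b = a + n\<close> the whole row of \<open>a\<close>
  is generated by chaining the translates \<open>(a + k * n, a + (k + 1) * n)\<close>.\<close>

lemma arc_subset_iff:
  assumes n: "0 < n" "a < b" "b \<le> a + n" and X: "tamari_set n X"
  shows "arc_inversions n a b \<subseteq> X \<longleftrightarrow> (a, b) \<in> X"
proof
  assume ab: "(a, b) \<in> X"
  have row: "(a, y) \<in> X" if y: "a < y" "b = a + n \<or> y \<le> b" for y
  proof (cases "y \<le> b")
    case True
    then show ?thesis using tamari_shrink[OF X ab] y by blast
  next
    case False
    then have b: "b = a + n" using y by blast
    have far: "(a, a + n + int k * n) \<in> X" for k
    proof (induction k)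
      case (Suc k)
      have "(a + (int k + 1) * n, b + (int k + 1) * n) \<in> X" using ab tamari_shift[OF X] by blast
      then show ?case using tamari_trans[OF X Suc] by (simp add: b algebra_simps)
    qed (use ab b in simp)
    have "(y - a) * 1 \<le> (y - a) * n" using n(1) y(1) by (intro mult_left_mono) auto
    then have "y \<le> a + n + (y - a) * n" using n(1) by (simp add: algebra_simps)
    then have "y \<le> a + n + int (nat (y - a)) * n" using y(1) by simp
    then show ?thesis using tamari_shrink[OF X far] y by blast
  qed
  show "arc_inversions n a b \<subseteq> X"
  proof clarify
    fix x y assume "(x, y) \<in> arc_inversions n a b"
    then obtain m where "x = a + m * n" "x < y" "b = a + n \<or> y \<le> b + m * n"
      unfolding arc_inversions_iff by blast
    then show "(x, y) \<in> X"
      using row[of "y - m * n"] tamari_shift[OF X, of a m "y - m * n"] by auto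
  qed
qed (use arc_top n in blast)

lemma subset_kappa_of_arc:
  assumes n: "0 < n" "a < b" "b \<le> a + n" and X: "tamari_set n X"
    and "(a, b) \<notin> X" "X \<subseteq> arc_inversions n a b"
  shows "X \<subseteq> kappa_inversions n a b"
proof (rule subset_kappa[OF X assms(5)])
  fix c assume c: "a < c" "c < b" "(c, b) \<in> X"
  then have "(c, b) \<in> arc_inversions n a b" using assms(6) by blast
  then obtain m where "c = a + m * n" unfolding arc_inversions_iff by blast
  moreover from this have "m = 0" using shift_zero[OF n(1), of m] c n(3) by linarith
  ultimately show False using c(1) by simp
qed

text \<open>The hypothesis says that the meet with \<open>j\<^sub>a\<^sub>,\<^sub>b\<close> is its lower cover, that is, the row of \<open>a\<close> ends
  exactly at \<open>b - 1\<close>. If the row of some \<open>c\<close> with \<open>a < c < b\<close> reached \<open>b\<close>, then so would the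
  row of \<open>a\<close>, by transitivity through \<open>(a, c)\<close>.\<close>

lemma kappa_maximal:
  assumes n: "0 < n" "a < b" "b \<le> a + n" and X: "tamari_set n X"
    and meet: "X \<inter> arc_inversions n a b = arc_inversions n a b \<inter> kappa_inversions n a b"
  shows "X \<subseteq> kappa_inversions n a b"
proof (rule subset_kappa[OF X])
  show ab: "(a, b) \<notin> X" using meet arc_top[OF n(2)] kappa_top[OF n(2)] by blast
  fix c assume c: "a < c" "c < b" "(c, b) \<in> X"
  have "(a, c) \<in> arc_inversions n a b"
    unfolding arc_inversions_iff using c by (auto intro!: exI[of _ 0])
  moreover have "(a, c) \<in> kappa_inversions n a b"
    unfolding kappa_inversions_def
  proof (clarify, intro conjI allI impI)
    fix m assume "a \<le> a + m * n" "a + m * n < b"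
    then have "m = 0" using shift_zero[OF n(1), of m] n(3) by linarith
    then show "c + m * n < b" using c by simp
  qed (rule c)
  ultimately have "(a, c) \<in> X" using meet by blast
  then show False using tamari_trans[OF X _ c(3)] ab by blast
qed

text \<open>A wall that is lost has a translate that starts in \<open>{a..<b}\<close> and reaches \<open>b\<close>. As \<open>(a, b)\<close> is a wall, no
  row starting strictly between \<open>a\<close> and \<open>b\<close> reaches \<open>b\<close>, so the translate starts at \<open>a\<close>, where there is
  only one wall.\<close>

lemma wall_not_kappa:
  assumes I: "tamari_set n I" and w: "wall I a b" "wall I a' b'"
    and nk: "(a', b') \<notin> kappa_inversions n a b"
  obtains m where "a = a' + m * n" "b = b' + m * n"
proof -
  have "(a', b') \<in> I" using w unfolding wall_def by blast
  then obtain m where m: "a \<le> a' + m * n" "a' + m * n < b" "b \<le> b' + m * n"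
    using not_kappaE[of I, OF _ _ nk] tamari_less[OF I] by blast
  note w' = wall_shift[OF I w(2), of m]
  then have "(a' + m * n, b) \<in> I"
    using tamari_shrink[OF I, of "a' + m * n" "b' + m * n" b] m unfolding wall_def by blast
  then have a: "a = a' + m * n" using w(1) m unfolding wall_def by (metis order_le_less)
  then have "b = b' + m * n" using wall_unique[OF I w(1)] w' by blast
  then show thesis using that a by blast
qed

lemma subset_of_lower_cover:
  assumes n: "0 < n" and I: "tamari_set n I" and X: "tamari_set n X" and w: "wall I a b"
    and "I \<inter> kappa_inversions n a b \<subseteq> X" "(a, b) \<in> X"
  shows "I \<subseteq> X"
proof (rule subset_if_walls[OF n I X])
  fix a' b' assume w': "wall I a' b'"
  show "(a', b') \<in> X"
  proof (cases "(a', b') \<in> kappa_inversions n a b")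
    case True
    then show ?thesis using assms(5) w' unfolding wall_def by blast
  next
    case False
    then obtain m where "a = a' + m * n" "b = b' + m * n"
      using wall_not_kappa[OF I w w'] by blast
    then show ?thesis using assms(6) tamari_shift[OF X, of a' m b'] by simp
  qed
qed

lemma arc_inversions_shift:
  "arc_inversions n (a + m * n) (b + m * n) = arc_inversions n a b"
proof -
  have "(\<exists>k. P k) \<longleftrightarrow> (\<exists>k. P (m + k))" for P :: "int \<Rightarrow> bool"
    by (metis add_diff_cancel_left' diff_add_cancel add.commute)
  note * = this[symmetric]
  have "(x, y) \<in> arc_inversions n (a + m * n) (b + m * n) \<longleftrightarrow> (x, y) \<in> arc_inversions n a b" for x y
    unfolding arc_inversions_iff
    using *[of "\<lambda>k. x = a + k * n \<and> x < y \<and> (b = a + n \<or> y \<le> b + k * n)"]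
    by (simp add: algebra_simps)
  then show ?thesis by auto
qed

text \<open>Since \<open>(c, d)\<close> is lost in the meet for \<open>(a, b)\<close>, a translate of it starts in \<open>{a..<b}\<close> and reaches \<open>b\<close>;
  as \<open>(a, b)\<close> is a wall, it starts at \<open>a\<close>, so it is \<open>(a, d')\<close> with \<open>b \<le> d'\<close>. Exchanging the roles,
  \<open>(a, b)\<close> is lost in the meet for \<open>(c, d)\<close>, which gives \<open>d' \<le> b\<close>.\<close>

lemma kappa_meet_determines_wall:
  assumes n: "0 < n" and I: "tamari_set n I" and w: "wall I a b"
    and c: "c < d" "d \<le> c + n" "(c, d) \<in> I"
    and eq: "I \<inter> kappa_inversions n c d = I \<inter> kappa_inversions n a b"
  obtains m where "a = c + m * n" "b = d + m * n"
proof -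
  have sub: "I \<subseteq> {(x, y). x < y}" using tamari_less[OF I] by blast
  have ab: "(a, b) \<in> I" "a < b" using w tamari_less[OF I] unfolding wall_def by blast+
  have "(c, d) \<notin> kappa_inversions n a b" using eq c kappa_top by blast
  then obtain m where m: "a \<le> c + m * n" "c + m * n < b" "b \<le> d + m * n"
    using not_kappaE[OF sub c(3)] by blast
  have "(c + m * n, d + m * n) \<in> I" using c(3) tamari_shift[OF I] by blast
  then have "(c + m * n, b) \<in> I" using tamari_shrink[OF I] m by blast
  then have a: "a = c + m * n" using w m unfolding wall_def by (metis order_le_less)
  have "(a, b) \<notin> kappa_inversions n c d" using eq ab kappa_top by blast
  then obtain k where k: "c \<le> a + k * n" "a + k * n < d" "d \<le> b + k * n"
    using not_kappaE[OF sub ab(1)] by blast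
  have sum: "(m + k) * n = m * n + k * n" by (simp add: algebra_simps)
  then have "m + k = 0"
    using shift_unique[OF n, of 0 "m + k" "(m + k) * n" 0] k c a by simp
  then have "m * n + k * n = 0" using sum by simp
  then have "b = d + m * n" using k m by linarith
  then show thesis using that a by blast
qed


section \<open>The join-irreducible elements and their \<open>\<kappa>\<close>\<close>

context
  fixes n :: int
  assumes n: "0 < n"
begin

abbreviation (input) "L \<equiv> CTam312 n"

context
  fixes a b :: int
  assumes ab: "a < b" "b \<le> a + n"
begin

lemma j_carrier: "j_elt n a b \<in> carrier L"
  and inversions_j: "inversions (j_elt n a b) = arc_inversions n a b"
  unfolding j_elt_eq[OF n ab]
  by (rule order_with_carrier inversions_order_with, rule tamari_set_arc[OF n ab])+

lemma j_subset_iff: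
  "r \<in> carrier L \<Longrightarrow> inversions (j_elt n a b) \<subseteq> inversions r \<longleftrightarrow> (a, b) \<in> inversions r"
  unfolding inversions_j by (rule arc_subset_iff[OF n ab tamari_set_inversions])

abbreviation (input) "j_star \<equiv> order_with (arc_inversions n a b \<inter> kappa_inversions n a b)"

lemma tamari_set_j_star: "tamari_set n (arc_inversions n a b \<inter> kappa_inversions n a b)"
  by (rule tamari_set_Int[OF tamari_set_arc[OF n ab] tamari_set_kappa])

lemmas j_star = order_with_carrier[OF tamari_set_j_star]
  inversions_order_with[OF tamari_set_j_star]

lemma j_star_less: "inversions j_star \<subset> inversions (j_elt n a b)"
  unfolding inversions_j j_star(2) using arc_top[OF ab(1)] kappa_top[OF ab(1)] by blast

text \<open>An element strictly below \<open>j\<^sub>a\<^sub>,\<^sub>b\<close> lacks the inversion \<open>(a, b)\<close>, because \<open>j\<^sub>a\<^sub>,\<^sub>b\<close> is the least element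
  that has it. So \<open>j\<^sub>a\<^sub>,\<^sub>b\<close> has a greatest element strictly below it, from which both the lower cover
  and join-irreducibility follow.\<close>

lemma below_j_star:
  assumes "x \<in> carrier L" "inversions x \<subset> inversions (j_elt n a b)"
  shows "inversions x \<subseteq> inversions j_star"
proof -
  have "(a, b) \<notin> inversions x" using assms j_subset_iff by blast
  then have "inversions x \<subseteq> kappa_inversions n a b"
    using subset_kappa_of_arc[OF n ab tamari_set_inversions[OF assms(1)]] assms(2) inversions_j
    by simp
  then show ?thesis using assms(2) unfolding j_star(2) inversions_j by blast
qed

lemma lower_cover_j: "lower_cover L (j_elt n a b) = j_star"
  unfolding lower_cover_def
proof (rule the_equality)
  have "\<not> inversions z \<subset> inversions (j_elt n a b)"
    if "z \<in> carrier L" "inversions j_star \<subset> inversions z" for z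
    using below_j_star[OF that(1)] that(2) by (meson psubset_subset_trans less_irrefl)
  then show "covers L j_star (j_elt n a b)"
    unfolding covers_CTam312 by (intro conjI ballI impI j_star(1) j_carrier j_star_less)
  fix x assume x: "covers L x (j_elt n a b)"
  then have c: "x \<in> carrier L" and less: "inversions x \<subset> inversions (j_elt n a b)"
    unfolding covers_CTam312 by simp_all
  have "\<not> inversions x \<subset> inversions j_star"
    using x j_star(1) j_star_less unfolding covers_CTam312 by metis
  then have "inversions x = inversions j_star" using below_j_star[OF c less] by blast
  then show "x = j_star" by (rule inversions_inject[OF c j_star(1)])
qed

lemma join_irreducible_j: "join_irreducible L (j_elt n a b)"
  unfolding join_irreducible_def
proof (intro conjI ballI impI)
  show "j_elt n a b \<in> carrier L" by (rule j_carrier)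
  show "\<not> least L (j_elt n a b) (carrier L)"
    using j_star(1) j_star_less j_carrier le_CTam312 unfolding least_def by blast
  fix x y assume x: "x \<in> carrier L" and y: "y \<in> carrier L" and j: "j_elt n a b = x \<squnion>\<^bsub>L\<^esub> y"
  have xy: "{x, y} \<subseteq> carrier L" using x y by blast
  note sup = sup_CTam312[OF xy, folded join_def, folded j]
  show "j_elt n a b = x \<or> j_elt n a b = y"
  proof (rule ccontr)
    assume "\<not> ?thesis"
    then have "inversions x \<subset> inversions (j_elt n a b)" "inversions y \<subset> inversions (j_elt n a b)"
      using sup(2)[of x] sup(2)[of y] inversions_inject[OF x j_carrier]
        inversions_inject[OF y j_carrier] by auto
    then have "inversions (j_elt n a b) \<subseteq> inversions j_star"
      using sup(3)[OF j_star(1)] below_j_star x y by blast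
    then show False using j_star_less by blast
  qed
qed

abbreviation (input) "kap \<equiv> order_with (kappa_inversions n a b)"

lemmas kap = order_with_carrier[OF tamari_set_kappa[of n a b]]
  inversions_order_with[OF tamari_set_kappa[of n a b]]

lemma meet_j_eq_j_star_iff:
  assumes "z \<in> carrier L"
  shows "z \<sqinter>\<^bsub>L\<^esub> j_elt n a b = j_star \<longleftrightarrow>
    inversions z \<inter> arc_inversions n a b = arc_inversions n a b \<inter> kappa_inversions n a b"
  unfolding meet_CTam312[OF assms j_carrier] inversions_j
  using inversions_order_with[OF tamari_set_j_star]
    inversions_order_with[OF tamari_set_Int[OF tamari_set_inversions[OF assms]
      tamari_set_arc[OF n ab]]] by metis

lemma kappa_j: "kappa L (j_elt n a b) = kap"
proof -
  interpret partial_order L by (rule partial_order_CTam312)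
  have gr: "greatest L kap {z \<in> carrier L. z \<sqinter>\<^bsub>L\<^esub> j_elt n a b = j_star}"
    unfolding greatest_def
  proof (intro conjI ballI)
    show "kap \<in> {z \<in> carrier L. z \<sqinter>\<^bsub>L\<^esub> j_elt n a b = j_star}"
      using kap meet_j_eq_j_star_iff[OF kap(1)] by blast
    fix z assume "z \<in> {z \<in> carrier L. z \<sqinter>\<^bsub>L\<^esub> j_elt n a b = j_star}"
    then have z: "z \<in> carrier L"
      "inversions z \<inter> arc_inversions n a b = arc_inversions n a b \<inter> kappa_inversions n a b"
      using meet_j_eq_j_star_iff by blast+
    then have "inversions z \<subseteq> kappa_inversions n a b"
      using kappa_maximal[OF n ab tamari_set_inversions] by blast
    then show "z \<sqsubseteq>\<^bsub>L\<^esub> kap" unfolding le_CTam312[OF z(1) kap(1)] kap(2) .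
  qed blast
  show ?thesis
    unfolding kappa_def lower_cover_j
  proof (rule the_equality)
    show "x = kap" if "greatest L x {z \<in> carrier L. z \<sqinter>\<^bsub>L\<^esub> j_elt n a b = j_star}" for x
      using that gr by (rule greatest_unique)
  qed (rule gr)
qed

end

lemma j_elt_shift:
  assumes "a < b" "b \<le> a + n"
  shows "j_elt n (a + m * n) (b + m * n) = j_elt n a b"
  using assms n by (simp add: j_elt_eq arc_inversions_shift)

text \<open>\<open>W\<close> is an arbitrary choice of walls that represents all of them up to translation.\<close>

lemma j_join_walls:
  assumes r: "r \<in> carrier L"
    and W: "\<And>a b. (a, b) \<in> W \<Longrightarrow> wall (inversions r) a b"
    and cover: "\<And>a b. wall (inversions r) a b \<Longrightarrow> \<exists>m. (a + m * n, b + m * n) \<in> W"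
  shows "\<Squnion>\<^bsub>L\<^esub> {j_elt n a b | a b. (a, b) \<in> W} = r"
proof -
  note I = tamari_set_inversions[OF r]
  have Wab: "a < b \<and> b \<le> a + n \<and> (a, b) \<in> inversions r" if "(a, b) \<in> W" for a b
    using W[OF that] wall_le[OF n I] tamari_less[OF I] unfolding wall_def by blast
  show ?thesis
  proof (rule sup_CTam312_eqI[OF r])
    show "{j_elt n a b | a b. (a, b) \<in> W} \<subseteq> carrier L" using Wab j_carrier by blast
    show "inversions x \<subseteq> inversions r" if "x \<in> {j_elt n a b | a b. (a, b) \<in> W}" for x
      using that Wab j_subset_iff[OF _ _ r] by blast
    fix z assume z: "z \<in> carrier L"
      and up: "\<And>x. x \<in> {j_elt n a b | a b. (a, b) \<in> W} \<Longrightarrow> inversions x \<subseteq> inversions z"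
    note Z = tamari_set_inversions[OF z]
    show "inversions r \<subseteq> inversions z"
    proof (rule subset_if_walls[OF n I Z])
      fix a b assume "wall (inversions r) a b"
      then obtain m where m: "(a + m * n, b + m * n) \<in> W" using cover by blast
      then have "inversions (j_elt n (a + m * n) (b + m * n)) \<subseteq> inversions z" using up by blast
      then have "(a + m * n, b + m * n) \<in> inversions z" using Wab[OF m] j_subset_iff z by blast
      then show "(a, b) \<in> inversions z" using tamari_shift[OF Z] by blast
    qed
  qed
qed

section \<open>Lower covers and their labels\<close>

context
  fixes r :: "int rel"
  assumes r: "r \<in> carrier L"
begin

abbreviation (input) "lower a b \<equiv> order_with (inversions r \<inter> kappa_inversions n a b)"

lemma lower:
  shows lower_carrier: "lower a b \<in> carrier L"
    and inversions_lower: "inversions (lower a b) = inversions r \<inter> kappa_inversions n a b"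
  using order_with_carrier inversions_order_with
    tamari_set_Int[OF tamari_set_inversions[OF r] tamari_set_kappa] by blast+

lemma wall_bounds:
  assumes "wall (inversions r) a b"
  shows "a < b" "b \<le> a + n" "(a, b) \<in> inversions r"
  using assms wall_le[OF n tamari_set_inversions[OF r]] tamari_less[OF tamari_set_inversions[OF r]]
  unfolding wall_def by blast+

lemma lower_less:
  assumes "wall (inversions r) a b"
  shows "inversions (lower a b) \<subset> inversions r"
  unfolding inversions_lower using wall_bounds[OF assms] kappa_top by blast

lemma below_lower:
  assumes "wall (inversions r) a b" "x \<in> carrier L" "inversions x \<subseteq> inversions r"
    "(a, b) \<notin> inversions x"
  shows "inversions x \<subseteq> inversions (lower a b)"
  using subset_kappa_of_wall[OF tamari_set_inversions[OF assms(2)] assms(4,1,3)] assms(3)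
  unfolding inversions_lower by blast

lemma above_lower:
  assumes "wall (inversions r) a b" "z \<in> carrier L" "inversions (lower a b) \<subseteq> inversions z"
    "(a, b) \<in> inversions z"
  shows "inversions r \<subseteq> inversions z"
  using subset_of_lower_cover[OF n tamari_set_inversions[OF r] tamari_set_inversions[OF assms(2)]]
    assms unfolding inversions_lower by blast

lemma covers_lower:
  assumes w: "wall (inversions r) a b"
  shows "covers L (lower a b) r"
  unfolding covers_CTam312
proof (intro conjI ballI impI notI lower_carrier r lower_less[OF w])
  fix z assume z: "z \<in> carrier L" "inversions (lower a b) \<subset> inversions z"
    "inversions z \<subset> inversions r"
  show False
  proof (cases "(a, b) \<in> inversions z")
    case True
    then show False using above_lower[OF w z(1)] z(2,3) by (metis leD psubset_imp_subset)
  next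
    case False
    then show False using below_lower[OF w z(1)] z(2,3) by (metis leD psubset_imp_subset)
  qed
qed

text \<open>An element strictly below \<open>r\<close> misses a wall of \<open>r\<close>, and therefore lies below the lower cover that
  belongs to this wall.\<close>

lemma covers_is_lower:
  assumes "covers L x r"
  obtains a b where "wall (inversions r) a b" "x = lower a b"
proof -
  have x: "x \<in> carrier L" "inversions x \<subset> inversions r"
    using assms unfolding covers_CTam312 by simp_all
  then obtain a b where w: "wall (inversions r) a b" "(a, b) \<notin> inversions x"
    using subset_if_walls[OF n tamari_set_inversions[OF r] tamari_set_inversions[OF x(1)]] by blast
  have "inversions x \<subseteq> inversions (lower a b)" using below_lower w x by blast
  moreover have "\<not> inversions x \<subset> inversions (lower a b)"
    using assms lower_carrier lower_less[OF w(1)] unfolding covers_CTam312 by metis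
  ultimately have "inversions x = inversions (lower a b)" by blast
  then have "x = lower a b" by (rule inversions_inject[OF x(1) lower_carrier])
  then show thesis using w that by blast
qed

text \<open>If \<open>r\<close> had two walls that are not translates of each other, the two lower covers belonging to them
  would have join \<open>r\<close>: the second cover retains the wall that the first one lost. Hence all walls
  are translates of one wall \<open>(a, b)\<close>, and \<open>r\<close> is the join of the single element \<open>j\<^sub>a\<^sub>,\<^sub>b\<close>.\<close>

lemma join_irreducible_is_j:
  assumes ji: "join_irreducible L r"
  obtains a b where "a < b" "b \<le> a + n" "r = j_elt n a b"
proof -
  note I = tamari_set_inversions[OF r]
  have "\<not> least L r (carrier L)" using ji unfolding join_irreducible_def by blast
  then have "inversions r \<noteq> {}"
    using r le_CTam312[OF r] unfolding least_def by blast
  then obtain a m where "(a, m) \<in> inversions r" by fast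
  then obtain b where w: "wall (inversions r) a b" using wall_exists[OF n I] by blast
  have same: "\<exists>m. a' + m * n = a \<and> b' + m * n = b" if w': "wall (inversions r) a' b'" for a' b'
  proof (rule ccontr)
    assume other: "\<not> ?thesis"
    have "\<Squnion>\<^bsub>L\<^esub> {lower a b, lower a' b'} = r"
    proof (rule sup_CTam312_eqI[OF r])
      show "{lower a b, lower a' b'} \<subseteq> carrier L" using lower_carrier by blast
      show "inversions x \<subseteq> inversions r" if "x \<in> {lower a b, lower a' b'}" for x
        using that inversions_lower by blast
      fix z assume z: "z \<in> carrier L"
        and up: "\<And>x. x \<in> {lower a b, lower a' b'} \<Longrightarrow> inversions x \<subseteq> inversions z"
      show "inversions r \<subseteq> inversions z"
      proof (rule above_lower[OF w z])
        show "inversions (lower a b) \<subseteq> inversions z" using up by blast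
        have "(a, b) \<in> kappa_inversions n a' b'"
        proof (rule ccontr)
          assume "(a, b) \<notin> kappa_inversions n a' b'"
          then obtain m where "a' = a + m * n" "b' = b + m * n"
            using wall_not_kappa[OF I w' w] by blast
          then have "a' + (- m) * n = a \<and> b' + (- m) * n = b" by simp
          then show False using other by blast
        qed
        then have "(a, b) \<in> inversions (lower a' b')"
          using wall_bounds[OF w] unfolding inversions_lower by blast
        then show "(a, b) \<in> inversions z" using up by blast
      qed
    qed
    then have "r = lower a b \<squnion>\<^bsub>L\<^esub> lower a' b'" unfolding join_def by simp
    then have "r = lower a b \<or> r = lower a' b'"
      using ji[unfolded join_irreducible_def] lower_carrier[of a b] lower_carrier[of a' b'] by metis
    then show False using lower_less[OF w] lower_less[OF w'] by (metis less_irrefl)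
  qed
  note ab = wall_bounds[OF w]
  have "\<exists>m. (a' + m * n, b' + m * n) \<in> {(a, b)}" if "wall (inversions r) a' b'" for a' b'
    using same[OF that] by simp
  then have "\<Squnion>\<^bsub>L\<^esub> {j_elt n a' b' | a' b'. (a', b') \<in> {(a, b)}} = r"
    using w by (intro j_join_walls[OF r]) auto
  moreover have "\<Squnion>\<^bsub>L\<^esub> {j_elt n a' b' | a' b'. (a', b') \<in> {(a, b)}} = j_elt n a b"
    using j_carrier[OF ab(1,2)] by (intro sup_CTam312_eqI) auto
  ultimately have "r = j_elt n a b" by simp
  then show thesis using that ab by blast
qed

end

text \<open>The join equation for \<open>j\<close> gives \<open>j \<le> r\<close>; the meet equation then identifies the wall.\<close>

lemma cover_label_lower:
  assumes r: "r \<in> carrier L" and w: "wall (inversions r) a b"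
  shows "cover_label L (order_with (inversions r \<inter> kappa_inversions n a b)) r = j_elt n a b"
  unfolding cover_label_def
proof (rule the_equality)
  let ?x = "order_with (inversions r \<inter> kappa_inversions n a b)"
  note I = tamari_set_inversions[OF r]
  note ab = wall_bounds[OF r w]
  note x = lower_carrier[OF r, of a b]
  have "\<Squnion>\<^bsub>L\<^esub> {j_elt n a b, ?x} = r"
  proof (rule sup_CTam312_eqI[OF r])
    show "{j_elt n a b, ?x} \<subseteq> carrier L" using j_carrier[OF ab(1,2)] x by blast
    show "inversions y \<subseteq> inversions r" if "y \<in> {j_elt n a b, ?x}" for y
      using that j_subset_iff[OF ab(1,2) r] ab(3) inversions_lower[OF r] by blast
    fix z assume z: "z \<in> carrier L"
      and up: "\<And>y. y \<in> {j_elt n a b, ?x} \<Longrightarrow> inversions y \<subseteq> inversions z"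
    show "inversions r \<subseteq> inversions z"
      using up j_subset_iff[OF ab(1,2) z] by (intro above_lower[OF r w z]) blast+
  qed
  moreover have "kappa L (j_elt n a b) \<sqinter>\<^bsub>L\<^esub> r = ?x"
    unfolding kappa_j[OF ab(1,2)] meet_CTam312[OF kap(1)[OF ab(1,2)] r] kap(2)[OF ab(1,2)]
    by (simp add: Int_commute)
  ultimately show "join_irreducible L (j_elt n a b) \<and> j_elt n a b \<squnion>\<^bsub>L\<^esub> ?x = r \<and>
      kappa L (j_elt n a b) \<sqinter>\<^bsub>L\<^esub> r = ?x"
    using join_irreducible_j[OF ab(1,2)] unfolding join_def by blast
  fix j assume "join_irreducible L j \<and> j \<squnion>\<^bsub>L\<^esub> ?x = r \<and> kappa L j \<sqinter>\<^bsub>L\<^esub> r = ?x"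
  then have j: "join_irreducible L j" "j \<squnion>\<^bsub>L\<^esub> ?x = r" "kappa L j \<sqinter>\<^bsub>L\<^esub> r = ?x" by blast+
  have jc: "j \<in> carrier L" using j(1) unfolding join_irreducible_def by blast
  obtain c d where cd: "c < d" "d \<le> c + n" "j = j_elt n c d"
    using join_irreducible_is_j[OF jc j(1)] by blast
  have "inversions j \<subseteq> inversions r"
    using sup_CTam312(2)[of "{j, ?x}" n j] jc x j(2) unfolding join_def by simp
  then have cdr: "(c, d) \<in> inversions r" using j_subset_iff[OF cd(1,2) r] cd(3) by blast
  have "inversions (kappa L j \<sqinter>\<^bsub>L\<^esub> r) = inversions r \<inter> kappa_inversions n c d"
    unfolding cd(3) kappa_j[OF cd(1,2)] inversions_meet[OF kap(1)[OF cd(1,2)] r] kap(2)[OF cd(1,2)]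
    by blast
  then have "inversions r \<inter> kappa_inversions n c d = inversions r \<inter> kappa_inversions n a b"
    unfolding j(3) inversions_lower[OF r] by simp
  then obtain m where "a = c + m * n" "b = d + m * n"
    using kappa_meet_determines_wall[OF n I w cd(1,2) cdr] by blast
  then show "j = j_elt n a b" using j_elt_shift[OF cd(1,2)] cd(3) by simp
qed

lemma canonical_join_rep_eq:
  assumes r: "r \<in> carrier L"
  shows "canonical_join_rep L r = {j_elt n a b | a b. wall (inversions r) a b}"
proof (intro equalityI subsetI)
  fix j assume "j \<in> canonical_join_rep L r"
  then obtain x where x: "covers L x r" "j = cover_label L x r"
    unfolding canonical_join_rep_def by blast
  obtain a b where w: "wall (inversions r) a b" and "x = lower r a b"
    using covers_is_lower[OF r x(1)] .
  then have "j = j_elt n a b" using x(2) cover_label_lower[OF r w] by simp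
  then show "j \<in> {j_elt n a b | a b. wall (inversions r) a b}" using w by blast
next
  fix j assume "j \<in> {j_elt n a b | a b. wall (inversions r) a b}"
  then obtain a b where j: "j = j_elt n a b" and w: "wall (inversions r) a b" by blast
  then have "j = cover_label L (lower r a b) r" using cover_label_lower[OF r w] by simp
  then show "j \<in> canonical_join_rep L r"
    using covers_lower[OF r w] unfolding canonical_join_rep_def by blast
qed

end

theorem corollary5p3:
  fixes n :: int and r :: "int rel" and k :: nat and a b :: "nat \<Rightarrow> int"
  assumes "n \<ge> 2"
    and "r \<in> carrier (CTam312 n)"
    and "arc_diagram n r = {refl_index n (a i) (b i) | i. i \<in> {1..k}}"
  shows "r = \<Squnion>\<^bsub>CTam312 n\<^esub> {j_elt n (a i) (b i) | i. i \<in> {1..k}} \<and>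
         canonical_join_rep (CTam312 n) r = {j_elt n (a i) (b i) | i. i \<in> {1..k}}"
proof -
  have n: "0 < n" using assms(1) by simp
  note r = assms(2)
  have t: "tito n r" using r by (simp add: carrier_CTam312)
  note I = tamari_set_inversions[OF r]
  define W where "W = {(a i, b i) | i. i \<in> {1..k}}"
  have sound: "wall (inversions r) c d" if "(c, d) \<in> W" for c d
  proof -
    have "refl_index n c d \<in> arc_diagram n r" using that unfolding W_def assms(3) by blast
    then obtain c' d' where eq: "refl_index n c d = refl_index n c' d'" and w: "lower_wall r c' d'"
      unfolding arc_diagram_def by blast
    have "(c + 0 * n, d + 0 * n) \<in> refl_index n c d" unfolding refl_index_def by blast
    then obtain m where "c = c' + m * n" "d = d' + m * n"
      unfolding eq by (auto simp: refl_index_def)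
    then show ?thesis using lower_wall_shift[OF t w] lower_wall_iff_wall[OF r] by simp
  qed
  have complete: "\<exists>m. (c + m * n, d + m * n) \<in> W" if "wall (inversions r) c d" for c d
  proof -
    have "refl_index n c d \<in> arc_diagram n r"
      using that lower_wall_iff_wall[OF r] unfolding arc_diagram_def by blast
    then obtain i where i: "i \<in> {1..k}" "refl_index n c d = refl_index n (a i) (b i)"
      unfolding assms(3) by blast
    have "(a i + 0 * n, b i + 0 * n) \<in> refl_index n (a i) (b i)" unfolding refl_index_def by blast
    then obtain m where "a i = c + m * n" "b i = d + m * n"
      unfolding i(2)[symmetric] by (auto simp: refl_index_def)
    then show ?thesis using i(1) unfolding W_def by (metis (mono_tags, lifting) CollectI)
  qed
  have J: "{j_elt n (a i) (b i) | i. i \<in> {1..k}} = {j_elt n c d | c d. (c, d) \<in> W}"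
    unfolding W_def by blast
  have "{j_elt n c d | c d. (c, d) \<in> W} = {j_elt n c d | c d. wall (inversions r) c d}"
  proof (intro equalityI subsetI)
    fix x assume "x \<in> {j_elt n c d | c d. wall (inversions r) c d}"
    then obtain c d where x: "x = j_elt n c d" "wall (inversions r) c d" by blast
    then obtain m where "(c + m * n, d + m * n) \<in> W" using complete by blast
    moreover have "x = j_elt n (c + m * n) (d + m * n)"
      using j_elt_shift[OF n wall_bounds(1,2)[OF n r x(2)]] x(1) by simp
    ultimately show "x \<in> {j_elt n c d | c d. (c, d) \<in> W}" by blast
  qed (use sound in blast)
  then show ?thesis
    unfolding J using j_join_walls[OF n r sound complete] canonical_join_rep_eq[OF n r] by simp
qed

end
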